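(* Consider the (over-parameterized) matrix trace regression $y=\mathscr A(X^* )+\varepsilon$ with $X^*\in\mathbb R^{p_1\times p_2}$ of rank $r^*$ and input rank $r\ge r^*$. Let the retraction $\mathcal H_r$ be the rank-$r$ truncated SVD. Suppose $\mathscr A$ satisfies $2r$-RIP. (RGD) Suppose the initialization $X^0$ satisfies $\|X^0-X^*\|_F\le\frac{R_{2r}}{1+R_{2r+r^*}-R_{2r}}\sigma_{r^*}(X^* )$. In addition, assume $R_{2r}\le\frac1{17}$ and $\sigma_{r^*}(X^* )\ge\frac{4(1+R_{2r+r^*}-R_{2r})}{R_{2r}(1-R_{2r})}\|(\mathscr A^*(\varepsilon))_{\max(2r)}\|_F$. Then $\{X^t\}$ generated by RGD satisfy, for all $t\ge0$, $$\|X^t-X^*\|_F\le2^{-t}\|X^0-X^*\|_F+\frac4{1-R_{2r}}\|(\mathscr A^*(\varepsilon))_{\max(2r)}\|_F.$$ (RGN) Suppose the initialization $X^0$ satisfies $\|X^0-X^*\|_F\le\frac{1-R_{2r}}{8(1+R_{2r+r^*}-R_{2r})}\sigma_{r^*}(X^* )$. Then $\{X^t\}$ generated by RGN satisfy, for all $t\ge0$, $$\|X^t-X^*\|_F\le2^{-2^t}\|X^0-X^*\|_F+\frac4{1-R_{2r}}\|(\mathscr A^*(\varepsilon))_{\max(2r)}\|_F.$$ Especially, if $\varepsilon=0$, $\|X^t-X^*\|_F\le2^{-t}\|X^0-X^*\|_F$ for RGD and $\|X^t-X^*\|_F\le2^{-2^t}\|X^0-X^*\|_F$ for RGN.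
   Context: $\mathscr A:\mathbb R^{p_1\times p_2}\to\mathbb R^n$, $\mathscr A(X)=(\langle A_i,X\rangle)_{i=1}^n$ for given matrices $A_i$, with adjoint $\mathscr A^*$. $\sigma_j(\cdot)$ is the $j$th largest singular value. For an integer $s$, $R_s$ is the smallest number such that $(1-R_s)\|Z\|_F^2\le\|\mathscr A(Z)\|_2^2\le(1+R_s)\|Z\|_F^2$ for all matrices $Z$ of rank at most $s$; $\mathscr A$ satisfies $s$-RIP (restricted isometry property) if $0\le R_s<1$. $Z_{\max(s)}$ is the best rank-$s$ approximation of $Z$ in Frobenius norm. For a rank-$r$ matrix $X$ with economic SVD $X=U\Sigma V^\top$, $P_{T_X}(Z)=P_UZP_V+P_{U_\perp}ZP_V+P_UZP_{V_\perp}$, where $P_U=UU^\top$, $P_{U_\perp}=I-P_U$ (similarly for $V$), is the orthogonal projector onto the tangent space $T_X\mathbb M_r$ at $X$ of the manifold $\mathbb M_r$ of rank-$r$ matrices. Algorithms, started from a rank-$r$ matrix $X^0$. Riemannian gradient descent (RGD): $G^t=P_{T_{X^t}}\mathscr A^*(\mathscr A(X^t)-y)$, $X^{t+0.5}=X^t-\frac{\|G^t\|_F^2}{\|\mathscr A(G^t)\|_2^2}G^t$. Riemannian Gauss–Newton (RGN): $X^{t+0.5}=\arg\min_{X\in T_{X^t}\mathbb M_r}\frac12\|y-\mathscr AP_{T_{X^t}}(X)\|_2^2$. Both: $X^{t+1}=\mathcal H_r(X^{t+0.5})$.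
   Formalization: The RGN bounds are proved for t≥1 (at t=0 they are false), and the noisy RGN bound under the extra condition σ_{r*}(X* ) ≥ 16(1+R_{2r+r*}−R_{2r})/(1−R_{2r})²·‖(A*(ε))_max(2r)‖_F, without which it can fail; r*≥1, and RGD's noise condition is cross-multiplied. *)

theory Defs
  imports "HOL-Analysis.Analysis"
begin

text \<open>
  Matrices in $R^{p_1 \times p_2}$ have type \<open>real^'q^'p\<close>. The inner product and the norm of this
  type are the Frobenius inner product and the Frobenius norm.
\<close>

definition meas_op :: "('n::finite \<Rightarrow> real^'q^'p) \<Rightarrow> real^'q^'p \<Rightarrow> real^'n" where
  "meas_op A X = (\<chi> i. A i \<bullet> X)"

definition outer :: "real^'p \<Rightarrow> real^'q \<Rightarrow> real^'q^'p" where
  "outer a b = (\<chi> i j. a $ i * b $ j)"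

definition orthonormal_family :: "nat \<Rightarrow> (nat \<Rightarrow> 'a::real_inner) \<Rightarrow> bool" where
  "orthonormal_family k u \<longleftrightarrow> (\<forall>i<k. \<forall>j<k. u i \<bullet> u j = (if i = j then 1 else 0))"

text \<open>
  A \<open>k\<close>-term SVD $X = U \Sigma V^T$; \<open>u i\<close> and \<open>v i\<close> (\<open>i < k\<close>) are the columns of $U$ and $V$. For
  \<open>k = rank X\<close> all \<open>s i\<close> are positive and this is the economic SVD; for \<open>k = max_rank X\<close> the
  \<open>s i\<close> are all the singular values of \<open>X\<close>.
\<close>

definition is_svd ::
  "nat \<Rightarrow> real^'q^'p \<Rightarrow> (nat \<Rightarrow> real^'p) \<Rightarrow> (nat \<Rightarrow> real) \<Rightarrow> (nat \<Rightarrow> real^'q) \<Rightarrow> bool" where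
  "is_svd k X u s v \<longleftrightarrow>
     orthonormal_family k u \<and> orthonormal_family k v \<and>
     (\<forall>i<k. 0 \<le> s i) \<and> (\<forall>i j. i \<le> j \<longrightarrow> j < k \<longrightarrow> s j \<le> s i) \<and>
     X = (\<Sum>i<k. s i *\<^sub>R outer (u i) (v i))"

definition max_rank :: "real^'q^'p \<Rightarrow> nat" where
  "max_rank X = min CARD('p) CARD('q)"

text \<open>The value does not depend on the chosen SVD. Meaningful for \<open>1 \<le> j \<le> max_rank X\<close>.\<close>

definition singular_value :: "nat \<Rightarrow> real^'q^'p \<Rightarrow> real" where
  "singular_value j X = (SOME \<sigma>. \<exists>u s v. is_svd (max_rank X) X u s v \<and> \<sigma> = s (j - 1))"

text \<open>The truncated SVD is not unique when singular values coincide, hence a relation.\<close>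

definition is_truncated_svd :: "nat \<Rightarrow> real^'q^'p \<Rightarrow> real^'q^'p \<Rightarrow> bool" where
  "is_truncated_svd r Z Y \<longleftrightarrow>
     (\<exists>u s v. is_svd (max_rank Z) Z u s v \<and>
        Y = (\<Sum>i<min r (max_rank Z). s i *\<^sub>R outer (u i) (v i)))"

text \<open>
  $Z_{\max(s)}$. A best approximation need not be unique, but all of them have the same norm.
\<close>

definition best_rank_approx :: "nat \<Rightarrow> real^'q^'p \<Rightarrow> real^'q^'p" where
  "best_rank_approx s Z = arg_min (\<lambda>Y. norm (Z - Y)) (\<lambda>Y. rank Y \<le> s)"

definition ric :: "('n::finite \<Rightarrow> real^'q^'p) \<Rightarrow> nat \<Rightarrow> real" where
  "ric A s = (LEAST R. \<forall>Z. rank Z \<le> s \<longrightarrow>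
     (1 - R) * (norm Z)\<^sup>2 \<le> (norm (meas_op A Z))\<^sup>2 \<and>
     (norm (meas_op A Z))\<^sup>2 \<le> (1 + R) * (norm Z)\<^sup>2)"

definition satisfies_rip :: "('n::finite \<Rightarrow> real^'q^'p) \<Rightarrow> nat \<Rightarrow> bool" where
  "satisfies_rip A s \<longleftrightarrow> 0 \<le> ric A s \<and> ric A s < 1"

text \<open>$U U^T$ for the matrix $U$ with columns \<open>u 0, \<dots>, u (k - 1)\<close>.\<close>

definition frame_proj :: "nat \<Rightarrow> (nat \<Rightarrow> real^'p) \<Rightarrow> real^'p^'p" where
  "frame_proj k u = (\<Sum>i<k. outer (u i) (u i))"

definition tangent_proj ::
  "nat \<Rightarrow> (nat \<Rightarrow> real^'p) \<Rightarrow> (nat \<Rightarrow> real^'q) \<Rightarrow> real^'q^'p \<Rightarrow> real^'q^'p" where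
  "tangent_proj k u v Z =
     (let PU = frame_proj k u; PV = frame_proj k v in
        PU ** Z ** PV + (mat 1 - PU) ** Z ** PV + PU ** Z ** (mat 1 - PV))"

text \<open>
  For \<open>rank X = r\<close> the \<open>r\<close>-term SVD is the economic SVD and \<open>P\<close> is uniquely determined: it is the
  orthogonal projector onto the tangent space at \<open>X\<close> of the manifold of rank-\<open>r\<close> matrices, and
  \<open>range P\<close> is that tangent space. An iterate may drop below rank \<open>r\<close>; then any \<open>r\<close>-term SVD,
  padded by zero singular values, may be used.
\<close>

definition is_tangent_proj :: "nat \<Rightarrow> real^'q^'p \<Rightarrow> (real^'q^'p \<Rightarrow> real^'q^'p) \<Rightarrow> bool" where
  "is_tangent_proj r X P \<longleftrightarrow> (\<exists>u s v. is_svd r X u s v \<and> P = tangent_proj r u v)"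

text \<open>If the Riemannian gradient \<open>G\<close> vanishes, the step is zero (\<open>0 / 0 = 0\<close>).\<close>

definition rgd_step ::
  "('n::finite \<Rightarrow> real^'q^'p) \<Rightarrow> real^'n \<Rightarrow> nat \<Rightarrow> real^'q^'p \<Rightarrow> real^'q^'p \<Rightarrow> bool" where
  "rgd_step A y r X X' \<longleftrightarrow>
     (\<exists>P. is_tangent_proj r X P \<and>
        (let G = P (adjoint (meas_op A) (meas_op A X - y)) in
           is_truncated_svd r (X - ((norm G)\<^sup>2 / (norm (meas_op A G))\<^sup>2) *\<^sub>R G) X'))"

definition rgn_step ::
  "('n::finite \<Rightarrow> real^'q^'p) \<Rightarrow> real^'n \<Rightarrow> nat \<Rightarrow> real^'q^'p \<Rightarrow> real^'q^'p \<Rightarrow> bool" where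
  "rgn_step A y r X X' \<longleftrightarrow>
     (\<exists>P Xh. is_tangent_proj r X P \<and>
        is_arg_min (\<lambda>Z. 1/2 * (norm (y - meas_op A (P Z)))\<^sup>2) (\<lambda>Z. Z \<in> range P) Xh \<and>
        is_truncated_svd r Xh X')"

definition rgd_iterates ::
  "('n::finite \<Rightarrow> real^'q^'p) \<Rightarrow> real^'n \<Rightarrow> nat \<Rightarrow> (nat \<Rightarrow> real^'q^'p) \<Rightarrow> bool" where
  "rgd_iterates A y r X \<longleftrightarrow> rank (X 0) = r \<and> (\<forall>t. rgd_step A y r (X t) (X (Suc t)))"

definition rgn_iterates ::
  "('n::finite \<Rightarrow> real^'q^'p) \<Rightarrow> real^'n \<Rightarrow> nat \<Rightarrow> (nat \<Rightarrow> real^'q^'p) \<Rightarrow> bool" where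
  "rgn_iterates A y r X \<longleftrightarrow> rank (X 0) = r \<and> (\<forall>t. rgn_step A y r (X t) (X (Suc t)))"

end

theory Submission
  imports Defs
begin

text \<open>
  Write \<open>P\<close> for the tangent projector at the current iterate \<open>X\<close> and \<open>e = norm (X - Xstar)\<close>.
  Restricted to the tangent space, whose elements have rank at most \<open>2 r\<close>, the measurement operator is a
  near isometry, so a half step would be exact up to the noise if \<open>Xstar\<close> were tangent, except for a
  contraction factor \<open>2 R / (1 - R)\<close> in the gradient method. What is left is the residual
  \<open>Xstar - P Xstar\<close>. It has rank at most \<open>rstar\<close>, is orthogonal to the tangent space, and is bounded by
  \<open>e\<^sup>2 / \<sigma>\<close>, so the restricted isometry constant of order \<open>2 r + rstar\<close> controls its influence.
  By Eckart--Young, truncation to rank \<open>r \<ge> rstar\<close> at most doubles the error.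
  This yields a scalar recurrence for \<open>e\<close>, which is linear with a quadratic perturbation for the gradient
  method and purely quadratic for Gauss--Newton.
\<close>

text \<open>In the over-parameterized case \<open>r > rstar\<close> the iterates may approach or
  reach rank below \<open>r\<close>, so no bound may involve the reciprocal of a singular value of
  \<open>X\<close>. The residual is therefore estimated through a pseudoinverse of
  \<open>Xstar\<close>, and only \<open>\<sigma>\<close>, the smallest positive singular value of
  \<open>Xstar\<close>, enters; zero singular values in an SVD of \<open>X\<close> are harmless. The
  constant \<open>1 + R' - R\<close> is the sum of \<open>R'\<close> from the cross term with the
  residual and \<open>1 - R\<close> from the passage from \<open>P Xstar\<close> back to
  \<open>Xstar\<close>, after multiplication by \<open>1 - R\<close>. \<open>singular_value\<close>,
  \<open>best_rank_approx\<close> and \<open>ric\<close> are given by choice or least-element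
  operators, so an object with the required property must be shown to exist before they can be used.
  This is the reason for the SVD existence proof and for \<open>ric_attained\<close>.\<close>

section \<open>Frobenius geometry of real matrices\<close>

lemma bilinear_matrix_mult:
  "bilinear ((**) :: real^'n^'m \<Rightarrow> real^'k^'n \<Rightarrow> real^'k^'m)"
  unfolding bilinear_def
  by (auto intro!: linearI simp: matrix_matrix_mult_def vec_eq_iff sum.distrib ring_distribs
      sum_distrib_left mult_ac)

lemmas matrix_mult_diff_left = bilinear_lsub [OF bilinear_matrix_mult]
  and matrix_mult_diff_right = bilinear_rsub [OF bilinear_matrix_mult]
  and matrix_mult_scaleR_left = bilinear_lmul [OF bilinear_matrix_mult]
  and matrix_mult_scaleR_right = bilinear_rmul [OF bilinear_matrix_mult]
  and matrix_mult_zero_left = bilinear_lzero [OF bilinear_matrix_mult]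

lemma matrix_mult_sum_right:
  fixes M :: "real^'n^'m" and f :: "'i \<Rightarrow> real^'k^'n"
  shows "M ** (\<Sum>i\<in>I. f i) = (\<Sum>i\<in>I. M ** f i)"
  using bilinear_matrix_mult[where ?'n = 'n and ?'m = 'm and ?'k = 'k]
  by (simp add: bilinear_def linear_sum)

lemma matrix_mult_sum_left:
  fixes M :: "real^'k^'n" and f :: "'i \<Rightarrow> real^'n^'m"
  shows "(\<Sum>i\<in>I. f i) ** M = (\<Sum>i\<in>I. f i ** M)"
proof -
  have "linear (\<lambda>x::real^'n^'m. x ** M)"
    using bilinear_matrix_mult unfolding bilinear_def by blast
  from linear_sum[OF this] show ?thesis by simp
qed

lemma sum_matrix_vector_mult:
  fixes f :: "'i \<Rightarrow> real^'n^'m"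
  shows "(\<Sum>i\<in>I. f i) *v x = (\<Sum>i\<in>I. f i *v x)"
  by (induction I rule: infinite_finite_induct) (simp_all add: matrix_vector_mult_add_rdistrib)

lemma outer_mult_vector: "outer a b *v x = (b \<bullet> x) *\<^sub>R a"
  by (simp add: outer_def matrix_vector_mult_def vec_eq_iff inner_vec_def sum_distrib_right
      sum_distrib_left mult_ac)

lemma inner_outer_outer: "outer a b \<bullet> outer c d = (a \<bullet> c) * (b \<bullet> d)"
proof -
  have "outer a b \<bullet> outer c d = (\<Sum>i\<in>UNIV. \<Sum>j\<in>UNIV. (a $ i * c $ i) * (b $ j * d $ j))"
    by (simp add: outer_def inner_vec_def mult_ac)
  also have "\<dots> = (a \<bullet> c) * (b \<bullet> d)"
    by (simp add: inner_vec_def sum_product)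
  finally show ?thesis .
qed

lemma transpose_outer: "transpose (outer a b) = outer b a"
  by (simp add: outer_def transpose_def mult.commute)

lemma matrix_mult_outer: "M ** outer a b = outer (M *v a) b"
  by (simp add: outer_def matrix_matrix_mult_def matrix_vector_mult_def vec_eq_iff
      sum_distrib_right mult.assoc)

lemma outer_mult_matrix: "outer a b ** M = outer a (transpose M *v b)"
  by (simp add: outer_def matrix_matrix_mult_def matrix_vector_mult_def vec_eq_iff transpose_def
      sum_distrib_left mult_ac)

lemma linear_transpose: "linear (transpose :: real^'n^'m \<Rightarrow> real^'m^'n)"
  by (auto intro!: linearI simp: transpose_def vec_eq_iff)

lemma matrix_mult_row: "(A ** B) $ i = (\<Sum>j\<in>UNIV. A $ i $ j *\<^sub>R B $ j)"
  for A :: "real^'n^'m" and B :: "real^'k^'n"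
  by (simp add: matrix_matrix_mult_def vec_eq_iff)

lemma inner_matrix_mult_left: "(M ** Z) \<bullet> W = Z \<bullet> (transpose M ** W)"
  for M :: "real^'n^'m"
proof -
  have "(M ** Z) \<bullet> W = (\<Sum>i\<in>UNIV. \<Sum>j\<in>UNIV. M $ i $ j * (Z $ j \<bullet> W $ i))"
    by (simp add: inner_vec_def[of "M ** Z"] matrix_mult_row inner_sum_left)
  also have "\<dots> = (\<Sum>j\<in>UNIV. \<Sum>i\<in>UNIV. M $ i $ j * (Z $ j \<bullet> W $ i))"
    by (rule sum.swap)
  also have "\<dots> = Z \<bullet> (transpose M ** W)"
    by (simp add: inner_vec_def[of Z] matrix_mult_row inner_sum_right transpose_def)
  finally show ?thesis .
qed

lemma inner_transpose_transpose: "transpose A \<bullet> transpose B = A \<bullet> B"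
  for A :: "real^'n^'m"
  by (simp add: inner_vec_def transpose_def) (rule sum.swap)

lemma norm_transpose: "norm (transpose A) = norm A" for A :: "real^'n^'m"
  by (simp add: norm_eq_sqrt_inner inner_transpose_transpose)

lemma inner_matrix_mult_right: "(Z ** M) \<bullet> W = Z \<bullet> (W ** transpose M)"
  for M :: "real^'n^'m"
proof -
  have "(Z ** M) \<bullet> W = (transpose M ** transpose Z) \<bullet> transpose W"
    by (metis inner_transpose_transpose matrix_transpose_mul)
  also have "\<dots> = transpose Z \<bullet> transpose (W ** transpose M)"
    by (simp add: inner_matrix_mult_left matrix_transpose_mul)
  finally show ?thesis
    by (simp add: inner_transpose_transpose)
qed

lemma norm_matrix_power2: "(norm Z)\<^sup>2 = (\<Sum>i\<in>UNIV. (norm (Z $ i))\<^sup>2)"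
  for Z :: "real^'n^'m"
  by (simp add: power2_norm_eq_inner inner_vec_def)

lemma norm_matrix_vector_mult_power2: "(norm (Z *v x))\<^sup>2 = (\<Sum>i\<in>UNIV. (Z $ i \<bullet> x)\<^sup>2)"
  for Z :: "real^'n^'m"
  by (simp add: power2_norm_eq_inner inner_vec_def[of "Z *v x"] matrix_vector_mul_component
      flip: power2_eq_square)

lemma norm_matrix_vector_mult_le: "norm (Z *v x) \<le> norm Z * norm x" for Z :: "real^'n^'m"
proof -
  have "(norm (Z *v x))\<^sup>2 = (\<Sum>i\<in>UNIV. (Z $ i \<bullet> x)\<^sup>2)"
    by (rule norm_matrix_vector_mult_power2)
  also have "\<dots> \<le> (\<Sum>i\<in>UNIV. (norm (Z $ i))\<^sup>2 * (norm x)\<^sup>2)"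
    by (intro sum_mono) (simp add: Cauchy_Schwarz_ineq power2_norm_eq_inner)
  also have "\<dots> = (norm Z * norm x)\<^sup>2"
    by (simp add: norm_matrix_power2 power_mult_distrib sum_distrib_right)
  finally show ?thesis
    by (rule power2_le_imp_le) simp
qed

lemma norm_matrix_mult_le: "norm (A ** B) \<le> norm A * norm B"
  for A :: "real^'n^'m" and B :: "real^'k^'n"
proof -
  have "(A ** B) $ i = transpose B *v (A $ i)" for i
    by (simp add: matrix_matrix_mult_def matrix_vector_mult_def transpose_def vec_eq_iff mult.commute)
  then have "(norm (A ** B))\<^sup>2 = (\<Sum>i\<in>UNIV. (norm (transpose B *v (A $ i)))\<^sup>2)"
    by (simp add: norm_matrix_power2)
  also have "\<dots> \<le> (\<Sum>i\<in>UNIV. (norm B * norm (A $ i))\<^sup>2)"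
    by (intro sum_mono power_mono) (metis norm_matrix_vector_mult_le norm_transpose, simp)
  also have "\<dots> = (norm A * norm B)\<^sup>2"
    by (simp add: norm_matrix_power2[of A] power_mult_distrib sum_distrib_left mult.commute)
  finally show ?thesis
    by (rule power2_le_imp_le) simp
qed

section \<open>Rank of sums and of rank-one combinations\<close>

lemma rank_add_le: "rank (A + B) \<le> rank A + rank B" for A :: "real^'n^'m"
proof -
  let ?S = "range ((*v) A)" and ?T = "range ((*v) B)"
  have sub: "subspace ?S" "subspace ?T"
    by (auto intro!: linear_subspace_image)
  have "range ((*v) (A + B)) \<subseteq> {x + y |x y. x \<in> ?S \<and> y \<in> ?T}"
    by (auto simp: matrix_vector_mult_add_rdistrib)
  then have "rank (A + B) \<le> dim {x + y |x y. x \<in> ?S \<and> y \<in> ?T}"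
    by (simp add: rank_dim_range dim_subset)
  also have "\<dots> \<le> rank A + rank B"
    using dim_sums_Int[OF sub] by (simp add: rank_dim_range)
  finally show ?thesis .
qed

lemma rank_scaleR_le: "rank (c *\<^sub>R A) \<le> rank A" for A :: "real^'n^'m"
proof -
  have "c *\<^sub>R A = mat c ** A"
    by (simp add: mat_def matrix_matrix_mult_def vec_eq_iff if_distribR sum.delta if_distrib[of "\<lambda>z. z * _"] cong: if_cong)
  then show ?thesis
    by (simp add: rank_mul_le_right)
qed

lemma rank_outer_le: "rank (outer a b) \<le> 1"
proof -
  have "range ((*v) (outer a b)) \<subseteq> span {a}"
    by (auto simp: outer_mult_vector intro: span_mul span_base)
  then have "dim (range ((*v) (outer a b))) \<le> dim {a}"
    by (metis dim_span dim_subset)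
  also have "\<dots> \<le> card {a}"
    by (rule dim_le_card') simp
  finally show ?thesis
    by (simp add: rank_dim_range)
qed

lemma rank_sum_outer_le:
  assumes "finite I"
  shows "rank (\<Sum>i\<in>I. c i *\<^sub>R outer (a i) (b i)) \<le> card I"
  using assms
proof (induction I rule: finite_induct)
  case (insert i I)
  have "rank (c i *\<^sub>R outer (a i) (b i)) \<le> 1"
    using rank_scaleR_le rank_outer_le le_trans by blast
  with insert show ?case
    using rank_add_le[of "c i *\<^sub>R outer (a i) (b i)" "\<Sum>i\<in>I. c i *\<^sub>R outer (a i) (b i)"]
    by simp
qed simp

section \<open>Orthonormal families: Bessel inequality, independence, bases\<close>

lemma bessel_inequality:
  assumes "orthonormal_family k u"
  shows "(\<Sum>i<k. (u i \<bullet> x)\<^sup>2) \<le> (norm x)\<^sup>2"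
proof -
  define p where "p = (\<Sum>i<k. (u i \<bullet> x) *\<^sub>R u i)"
  have px: "p \<bullet> x = (\<Sum>i<k. (u i \<bullet> x)\<^sup>2)"
    by (simp add: p_def inner_sum_left power2_eq_square)
  have "u i \<bullet> p = u i \<bullet> x" if "i < k" for i
  proof -
    have "u i \<bullet> p = (\<Sum>j<k. if j = i then u j \<bullet> x else 0)"
      unfolding p_def inner_sum_right
      using assms that by (intro sum.cong) (auto simp: orthonormal_family_def)
    then show ?thesis using that by simp
  qed
  then have "p \<bullet> p = (\<Sum>i<k. (u i \<bullet> x)\<^sup>2)"
    by (subst p_def) (simp add: inner_sum_left power2_eq_square)
  with px have "(norm (x - p))\<^sup>2 = (norm x)\<^sup>2 - (\<Sum>i<k. (u i \<bullet> x)\<^sup>2)"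
    by (simp add: power2_norm_eq_inner inner_diff inner_commute)
  then show ?thesis
    by (smt (verit) zero_le_power2)
qed

lemma bessel_inequality_matrix:
  fixes Y :: "real^'q^'p"
  assumes "orthonormal_family k v"
  shows "(\<Sum>i<k. (norm (Y *v v i))\<^sup>2) \<le> (norm Y)\<^sup>2"
proof -
  have "(\<Sum>i<k. (norm (Y *v v i))\<^sup>2) = (\<Sum>i<k. \<Sum>j\<in>UNIV. (v i \<bullet> Y $ j)\<^sup>2)"
    by (simp add: norm_matrix_vector_mult_power2 inner_commute)
  also have "\<dots> = (\<Sum>j\<in>UNIV. \<Sum>i<k. (v i \<bullet> Y $ j)\<^sup>2)"
    by (rule sum.swap)
  also have "\<dots> \<le> (norm Y)\<^sup>2"
    by (subst norm_matrix_power2) (intro sum_mono bessel_inequality assms)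
  finally show ?thesis .
qed

lemma orthonormal_family_card_le_dim:
  fixes u :: "nat \<Rightarrow> 'a::euclidean_space"
  assumes "orthonormal_family k u" and "\<And>i. i < k \<Longrightarrow> u i \<in> S"
  shows "k \<le> dim S"
proof -
  have inj: "inj_on u {..<k}"
  proof (rule inj_onI)
    fix i j assume "i \<in> {..<k}" "j \<in> {..<k}" "u i = u j"
    with assms(1) show "i = j"
      unfolding orthonormal_family_def by (metis lessThan_iff zero_neq_one)
  qed
  have "0 \<notin> u ` {..<k}"
    using assms(1) unfolding orthonormal_family_def
    by (metis imageE inner_zero_left lessThan_iff zero_neq_one)
  moreover have "pairwise orthogonal (u ` {..<k})"
    using assms(1) by (auto simp: pairwise_def orthogonal_def orthonormal_family_def)
  ultimately have "independent (u ` {..<k})"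
    by (rule pairwise_orthogonal_independent[rotated])
  then have "card (u ` {..<k}) \<le> dim S"
    using assms(2) by (intro independent_card_le_dim) auto
  then show ?thesis
    by (simp add: card_image[OF inj])
qed

lemma orthonormal_family_spans:
  fixes u :: "nat \<Rightarrow> 'a::euclidean_space"
  assumes "orthonormal_family (DIM('a)) u"
  shows "span (u ` {..<DIM('a)}) = UNIV"
proof -
  have "DIM('a) \<le> dim (u ` {..<DIM('a)})"
    using assms by (rule orthonormal_family_card_le_dim) simp
  then show ?thesis
    using dim_subset_UNIV[of "u ` {..<DIM('a)}"] by (metis dim_eq_full le_antisym)
qed

lemma obtain_orthonormal_family:
  fixes S :: "'a::euclidean_space set"
  assumes "subspace S"
  obtains e where "orthonormal_family (dim S) e" "span (e ` {..<dim S}) = S"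
proof -
  obtain B where B: "pairwise orthogonal B" "\<And>x. x \<in> B \<Longrightarrow> norm x = 1"
      "independent B" "card B = dim S" "span B = S"
    using orthonormal_basis_subspace[OF assms] by metis
  obtain e where e: "bij_betw e {..<dim S} B"
    by (metis B(3,4) ex_bij_betw_nat_finite independent_imp_finite lessThan_atLeast0)
  have "orthonormal_family (dim S) e"
    unfolding orthonormal_family_def
  proof (intro allI impI)
    fix i j assume ij: "i < dim S" "j < dim S"
    then have mem: "e i \<in> B" "e j \<in> B"
      using e by (auto simp: bij_betw_def)
    show "e i \<bullet> e j = (if i = j then 1 else 0)"
    proof (cases "i = j")
      case True
      then show ?thesis using B(2)[OF mem(1)] by (simp add: norm_eq_1)
    next
      case False
      then have "e i \<noteq> e j"
        using e ij by (auto simp: bij_betw_def inj_on_def)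
      then show ?thesis
        using B(1) mem False by (auto simp: pairwise_def orthogonal_def)
    qed
  qed
  moreover have "span (e ` {..<dim S}) = S"
    using e B(5) by (simp add: bij_betw_def)
  ultimately show thesis by (rule that)
qed

section \<open>Orthogonal projectors built from orthonormal families\<close>

lemma frame_proj_mult_vector: "frame_proj k u *v x = (\<Sum>i<k. (u i \<bullet> x) *\<^sub>R u i)"
  by (simp add: frame_proj_def sum_matrix_vector_mult outer_mult_vector)

lemma transpose_frame_proj: "transpose (frame_proj k u) = frame_proj k u"
  by (simp add: frame_proj_def linear_sum[OF linear_transpose] transpose_outer)

lemma frame_proj_mult_member:
  assumes "orthonormal_family k u" "i < k"
  shows "frame_proj k u *v u i = u i"
proof -
  have "frame_proj k u *v u i = (\<Sum>j<k. if j = i then u j else 0)"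
    unfolding frame_proj_mult_vector
    using assms by (intro sum.cong) (auto simp: orthonormal_family_def)
  then show ?thesis
    using assms by simp
qed

lemma frame_proj_idem:
  assumes "orthonormal_family k u"
  shows "frame_proj k u ** frame_proj k u = frame_proj k u"
proof -
  have "frame_proj k u ** frame_proj k u = (\<Sum>i<k. outer (frame_proj k u *v u i) (u i))"
    by (subst (2) frame_proj_def) (simp add: matrix_mult_sum_right matrix_mult_outer)
  also have "\<dots> = frame_proj k u"
    by (subst (2) frame_proj_def) (simp add: frame_proj_mult_member[OF assms])
  finally show ?thesis .
qed

lemma frame_proj_mult_span:
  assumes "orthonormal_family k u" "x \<in> span (u ` {..<k})"
  shows "frame_proj k u *v x = x"
  using assms(2)
proof (induction rule: span_induct_alt)
  case base
  then show ?case by simp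
next
  case (step c x y)
  then show ?case
    using frame_proj_mult_member[OF assms(1)]
    by (auto simp: matrix_vector_right_distrib matrix_vector_mult_scaleR)
qed

lemma rank_frame_proj_le: "rank (frame_proj k u) \<le> k"
  using rank_sum_outer_le[of "{..<k}" "\<lambda>_. 1" u u] by (simp add: frame_proj_def)

lemma norm_power2_split_proj:
  fixes Q :: "real^'m^'m" and Z :: "real^'n^'m"
  assumes "transpose Q = Q" "Q ** Q = Q"
  shows "(norm Z)\<^sup>2 = (norm (Q ** Z))\<^sup>2 + (norm ((mat 1 - Q) ** Z))\<^sup>2"
proof -
  have "(Q ** Z) \<bullet> (Q ** Z) = Z \<bullet> (Q ** Z)"
    by (subst inner_matrix_mult_left) (simp add: assms matrix_mul_assoc)
  then show ?thesis
    by (simp add: power2_norm_eq_inner matrix_mult_diff_left inner_diff inner_commute)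
qed

lemma norm_proj_mult_le:
  fixes Q :: "real^'m^'m" and Z :: "real^'n^'m"
  assumes "transpose Q = Q" "Q ** Q = Q"
  shows "norm (Q ** Z) \<le> norm Z" "norm ((mat 1 - Q) ** Z) \<le> norm Z"
proof -
  have "(norm (Q ** Z))\<^sup>2 \<le> (norm Z)\<^sup>2" "(norm ((mat 1 - Q) ** Z))\<^sup>2 \<le> (norm Z)\<^sup>2"
    using norm_power2_split_proj[OF assms, of Z] by simp_all
  then show "norm (Q ** Z) \<le> norm Z" "norm ((mat 1 - Q) ** Z) \<le> norm Z"
    by (simp_all add: power2_le_iff_abs_le)
qed

lemma norm_mult_proj_le:
  fixes Q :: "real^'m^'m" and Z :: "real^'m^'n"
  assumes "transpose Q = Q" "Q ** Q = Q"
  shows "norm (Z ** (mat 1 - Q)) \<le> norm Z"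
proof -
  have "transpose (Z ** (mat 1 - Q)) = (mat 1 - Q) ** transpose Z"
    by (simp add: matrix_transpose_mul linear_diff[OF linear_transpose] assms transpose_mat)
  then show ?thesis
    by (metis norm_proj_mult_le(2)[OF assms] norm_transpose)
qed

text \<open>Orthonormality of the second factors alone makes the summands orthogonal. The first
  factors stay arbitrary, so the formula still applies after such a sum is multiplied from the left
  by a projector or another matrix.\<close>

lemma norm_power2_sum_outer:
  assumes "orthonormal_family k v"
  shows "(norm (\<Sum>i<k. c i *\<^sub>R outer (a i) (v i)))\<^sup>2 = (\<Sum>i<k. (c i)\<^sup>2 * (norm (a i))\<^sup>2)"
proof -
  have "(\<Sum>j<k. c i * (c j * ((a i \<bullet> a j) * (v i \<bullet> v j)))) = (c i)\<^sup>2 * (norm (a i))\<^sup>2"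
    if "i < k" for i
  proof -
    have "(\<Sum>j<k. c i * (c j * ((a i \<bullet> a j) * (v i \<bullet> v j)))) =
        (\<Sum>j<k. if j = i then (c i)\<^sup>2 * (norm (a i))\<^sup>2 else 0)"
      using assms that
      by (intro sum.cong) (auto simp: orthonormal_family_def power2_norm_eq_inner power2_eq_square[of "c _"])
    then show ?thesis using that by simp
  qed
  then have "(\<Sum>i<k. \<Sum>j<k. c i * (c j * ((a i \<bullet> a j) * (v i \<bullet> v j)))) =
      (\<Sum>i<k. (c i)\<^sup>2 * (norm (a i))\<^sup>2)"
    by simp
  then show ?thesis
    unfolding power2_norm_eq_inner[of "sum _ _"] inner_sum_left
    by (simp add: inner_sum_right inner_outer_outer sum_distrib_left mult.left_commute)
qed

section \<open>Singular value decomposition\<close>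

lemma obtain_unit_orthogonal:
  fixes u :: "nat \<Rightarrow> 'a::euclidean_space"
  assumes "k < DIM('a)"
  obtains a where "norm a = 1" "\<And>i. i < k \<Longrightarrow> a \<bullet> u i = 0"
proof -
  have "dim (span (u ` {..<k})) \<le> card (u ` {..<k})"
    by (simp add: dim_le_card')
  also have "\<dots> \<le> k"
    using card_image_le[of "{..<k}" u] by simp
  finally have "dim (u ` {..<k}) < DIM('a)"
    using assms by simp
  then obtain x where x: "x \<noteq> 0" "\<And>y. y \<in> span (u ` {..<k}) \<Longrightarrow> orthogonal x y"
    using orthogonal_to_subspace_exists by metis
  show thesis
  proof (rule that)
    show "norm (x /\<^sub>R norm x) = 1"
      using x(1) by simp
    show "(x /\<^sub>R norm x) \<bullet> u i = 0" if "i < k" for i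
      using x(2)[of "u i"] that by (simp add: orthogonal_def span_base)
  qed
qed

lemma inner_matrix_vector_mult: "a \<bullet> (X *v b) = (transpose X *v a) \<bullet> b" for X :: "real^'q^'p"
  by (metis dot_lmul_matrix transpose_matrix_vector)

text \<open>Since \<open>X *v b\<close> is itself orthogonal to all \<open>u i\<close>, its
  normalization is an admissible \<open>a'\<close>, which gives
  \<open>norm (X *v b) \<le> t\<close>. The inner product with the unit vector \<open>a\<close>
  attains \<open>t\<close>, so this is the equality case of Cauchy--Schwarz.\<close>

lemma maximal_image_eq:
  fixes X :: "real^'q^'p"
  assumes "norm a = 1" and "0 \<le> t" and "a \<bullet> (X *v b) = t"
    and "\<And>a'. norm a' = 1 \<Longrightarrow> (\<forall>i<k. a' \<bullet> u i = 0) \<Longrightarrow> a' \<bullet> (X *v b) \<le> t"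
    and "\<And>i. i < k \<Longrightarrow> u i \<bullet> (X *v b) = 0"
  shows "X *v b = t *\<^sub>R a"
proof -
  let ?y = "X *v b"
  have "norm ?y \<le> t"
  proof (cases "?y = 0")
    case False
    have "norm (?y /\<^sub>R norm ?y) = 1"
      using False by simp
    moreover have "\<forall>i<k. (?y /\<^sub>R norm ?y) \<bullet> u i = 0"
      using assms(5) by (simp add: inner_commute)
    ultimately have "(?y /\<^sub>R norm ?y) \<bullet> ?y \<le> t"
      by (rule assms(4))
    then show ?thesis
      using False by (simp add: dot_square_norm power2_eq_square field_simps)
  qed (use assms(2) in simp)
  then have "(norm ?y)\<^sup>2 \<le> t\<^sup>2"
    by (simp add: power_mono)
  moreover have "(norm (?y - t *\<^sub>R a))\<^sup>2 = (norm ?y)\<^sup>2 - t\<^sup>2"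
    using assms(1,3)
    by (simp add: power2_norm_eq_inner inner_diff inner_commute norm_eq_1 power2_eq_square[of t])
  ultimately show ?thesis
    by (smt (verit) eq_iff_diff_eq_0 norm_le_zero_iff power2_less_eq_zero_iff)
qed

text \<open>The next singular triple maximizes \<open>a \<bullet> (X *v b)\<close> over unit vectors
  orthogonal to the earlier singular vectors. Compactness gives a maximizer, and maximality in each
  argument separately gives the two singular vector equations.\<close>

lemma partial_svd_step:
  fixes X :: "real^'q^'p"
  assumes k: "k < CARD('p)" "k < CARD('q)"
    and Xv: "\<And>i. i < k \<Longrightarrow> X *v v i = s i *\<^sub>R u i"
    and Xu: "\<And>i. i < k \<Longrightarrow> transpose X *v u i = s i *\<^sub>R v i"
  obtains a b t where "norm a = 1" "norm b = 1"
    "\<forall>i<k. a \<bullet> u i = 0" "\<forall>i<k. b \<bullet> v i = 0" "0 \<le> t"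
    "X *v b = t *\<^sub>R a" "transpose X *v a = t *\<^sub>R b"
    "\<And>a' b'. norm a' = 1 \<Longrightarrow> norm b' = 1 \<Longrightarrow> \<forall>i<k. a' \<bullet> u i = 0 \<Longrightarrow>
      \<forall>i<k. b' \<bullet> v i = 0 \<Longrightarrow> a' \<bullet> (X *v b') \<le> t"
proof -
  define SA where "SA = sphere 0 1 \<inter> (\<Inter>i\<in>{..<k}. {a. a \<bullet> u i = 0})"
  define SB where "SB = sphere 0 1 \<inter> (\<Inter>i\<in>{..<k}. {b. b \<bullet> v i = 0})"
  have SA: "a \<in> SA \<longleftrightarrow> norm a = 1 \<and> (\<forall>i<k. a \<bullet> u i = 0)" for a
    by (auto simp: SA_def)
  have SB: "b \<in> SB \<longleftrightarrow> norm b = 1 \<and> (\<forall>i<k. b \<bullet> v i = 0)" for b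
    by (auto simp: SB_def)
  have "closed {x. x \<bullet> w = 0}" for w :: "'a::euclidean_space"
    using closed_hyperplane[of w 0] by (simp add: inner_commute)
  then have "compact SA" "compact SB"
    unfolding SA_def SB_def by (auto intro!: compact_Int_closed closed_INT)
  moreover obtain a0 where "a0 \<in> SA"
    using obtain_unit_orthogonal[of k u] k SA by (metis DIM_cart DIM_real mult_1_right)
  moreover obtain b0 where "b0 \<in> SB"
    using obtain_unit_orthogonal[of k v] k SB by (metis DIM_cart DIM_real mult_1_right)
  moreover have "continuous_on (SA \<times> SB) (\<lambda>z. fst z \<bullet> (X *v snd z))"
  proof -
    have "bounded_linear ((*v) X)"
      by (simp add: linear_conv_bounded_linear[symmetric])
    then have "continuous_on (SA \<times> SB) (\<lambda>z. X *v snd z)"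
      by (rule bounded_linear.continuous_on) (rule continuous_on_snd[OF continuous_on_id])
    then show ?thesis
      by (intro continuous_on_inner continuous_on_fst[OF continuous_on_id])
  qed
  ultimately have "\<exists>z\<in>SA \<times> SB. \<forall>z'\<in>SA \<times> SB. fst z' \<bullet> (X *v snd z') \<le> fst z \<bullet> (X *v snd z)"
    by (intro continuous_attains_sup compact_Times) auto
  then obtain z where z: "z \<in> SA \<times> SB"
      "\<And>z'. z' \<in> SA \<times> SB \<Longrightarrow> fst z' \<bullet> (X *v snd z') \<le> fst z \<bullet> (X *v snd z)"
    by blast
  define a b t where "a = fst z" and "b = snd z" and "t = a \<bullet> (X *v b)"
  have ab: "a \<in> SA" "b \<in> SB"
    using z(1) by (auto simp: a_def b_def)
  have max: "a' \<bullet> (X *v b') \<le> t" if "a' \<in> SA" "b' \<in> SB" for a' b'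
    using z(2)[of "(a', b')"] that by (simp add: t_def a_def b_def)
  have "- a \<in> SA"
    using ab SA by simp
  then have "(- a) \<bullet> (X *v b) \<le> t"
    using max ab by blast
  then have t: "0 \<le> t"
    by (simp add: t_def)
  have 1: "X *v b = t *\<^sub>R a"
  proof (rule maximal_image_eq[where k = k and u = u])
    show "u i \<bullet> (X *v b) = 0" if "i < k" for i
      using ab that SB Xu[OF that] by (metis inner_commute inner_matrix_vector_mult inner_scaleR_left mult_zero_right)
  qed (use ab SA SB t max in \<open>auto simp: t_def\<close>)
  have 2: "transpose X *v a = t *\<^sub>R b"
  proof (rule maximal_image_eq[where k = k and u = v])
    show "v i \<bullet> (transpose X *v a) = 0" if "i < k" for i
      using ab that SA Xv[OF that] by (metis inner_commute inner_matrix_vector_mult inner_scaleR_right mult_zero_right)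
    show "b \<bullet> (transpose X *v a) = t"
      unfolding t_def by (metis inner_commute inner_matrix_vector_mult)
    show "b' \<bullet> (transpose X *v a) \<le> t" if "norm b' = 1" "\<forall>i<k. b' \<bullet> v i = 0" for b'
      using max[OF ab(1), of b'] SB that by (metis inner_commute inner_matrix_vector_mult)
  qed (use ab SA SB t max in auto)
  show thesis
    using that[OF _ _ _ _ t 1 2] ab SA SB max by blast
qed

lemma orthonormal_family_extend:
  assumes "orthonormal_family k u" "norm a = 1" "\<forall>i<k. a \<bullet> u i = 0"
  shows "orthonormal_family (Suc k) (u(k := a))"
  using assms by (auto simp: orthonormal_family_def less_Suc_eq norm_eq_1 inner_commute)

text \<open>The last conjunct strengthens the induction: the next pair of vectors is an admissible
  competitor in it, so its value cannot exceed the earlier ones and the ordering persists.\<close>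

lemma partial_svd_exists:
  fixes X :: "real^'q^'p"
  assumes "k \<le> min CARD('p) CARD('q)"
  shows "\<exists>u s v. orthonormal_family k u \<and> orthonormal_family k v \<and>
     (\<forall>i<k. 0 \<le> s i) \<and> (\<forall>i j. i \<le> j \<longrightarrow> j < k \<longrightarrow> s j \<le> s i) \<and>
     (\<forall>i<k. X *v v i = s i *\<^sub>R u i) \<and> (\<forall>i<k. transpose X *v u i = s i *\<^sub>R v i) \<and>
     (\<forall>a b. norm a = 1 \<longrightarrow> norm b = 1 \<longrightarrow> (\<forall>i<k. a \<bullet> u i = 0) \<longrightarrow> (\<forall>i<k. b \<bullet> v i = 0) \<longrightarrow>
        (\<forall>i<k. a \<bullet> (X *v b) \<le> s i))"
  using assms
proof (induction k)
  case 0
  then show ?case by (auto simp: orthonormal_family_def)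
next
  case (Suc k)
  then obtain u s v where *: "orthonormal_family k u" "orthonormal_family k v"
     "\<forall>i<k. 0 \<le> s i" "\<forall>i j. i \<le> j \<longrightarrow> j < k \<longrightarrow> s j \<le> s i"
     "\<forall>i<k. X *v v i = s i *\<^sub>R u i" "\<forall>i<k. transpose X *v u i = s i *\<^sub>R v i"
     "\<forall>a b. norm a = 1 \<longrightarrow> norm b = 1 \<longrightarrow> (\<forall>i<k. a \<bullet> u i = 0) \<longrightarrow> (\<forall>i<k. b \<bullet> v i = 0) \<longrightarrow>
        (\<forall>i<k. a \<bullet> (X *v b) \<le> s i)"
    by auto
  obtain a b t where ab: "norm a = 1" "norm b = 1"
    "\<forall>i<k. a \<bullet> u i = 0" "\<forall>i<k. b \<bullet> v i = 0" "0 \<le> t"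
    "X *v b = t *\<^sub>R a" "transpose X *v a = t *\<^sub>R b"
    and max: "\<And>a' b'. norm a' = 1 \<Longrightarrow> norm b' = 1 \<Longrightarrow> \<forall>i<k. a' \<bullet> u i = 0 \<Longrightarrow>
      \<forall>i<k. b' \<bullet> v i = 0 \<Longrightarrow> a' \<bullet> (X *v b') \<le> t"
    using Suc.prems *(5,6) by (elim partial_svd_step[rotated -1]) auto
  have "a \<bullet> (X *v b) = t"
    using ab by (simp add: norm_eq_1)
  then have t: "t \<le> s i" if "i < k" for i
    using *(7) ab that by metis
  show ?case
  proof (intro exI conjI)
    show "orthonormal_family (Suc k) (u(k := a))" "orthonormal_family (Suc k) (v(k := b))"
      using * ab by (simp_all add: orthonormal_family_extend)
    show "\<forall>i<Suc k. 0 \<le> (s(k := t)) i"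
      using * ab by (simp add: less_Suc_eq)
    show "\<forall>i j. i \<le> j \<longrightarrow> j < Suc k \<longrightarrow> (s(k := t)) j \<le> (s(k := t)) i"
      using *(4) t by (auto simp: less_Suc_eq)
    show "\<forall>i<Suc k. X *v (v(k := b)) i = (s(k := t)) i *\<^sub>R (u(k := a)) i"
      "\<forall>i<Suc k. transpose X *v (u(k := a)) i = (s(k := t)) i *\<^sub>R (v(k := b)) i"
      using * ab by (auto simp: less_Suc_eq)
    show "\<forall>a' b'. norm a' = 1 \<longrightarrow> norm b' = 1 \<longrightarrow> (\<forall>i<Suc k. a' \<bullet> (u(k := a)) i = 0) \<longrightarrow>
        (\<forall>i<Suc k. b' \<bullet> (v(k := b)) i = 0) \<longrightarrow> (\<forall>i<Suc k. a' \<bullet> (X *v b') \<le> (s(k := t)) i)"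
      using *(7) max by (auto simp: less_Suc_eq)
  qed
qed

lemma matrix_eq_0_if_zero_on_basis:
  fixes D :: "real^'q^'p"
  assumes "orthonormal_family CARD('q) v" "\<And>i. i < CARD('q) \<Longrightarrow> D *v v i = 0"
  shows "D = 0"
proof -
  have "span (v ` {..<CARD('q)}) = UNIV"
    using orthonormal_family_spans[of v] assms(1) by simp
  then have "D *v x = 0" for x
    using linear_eq_0_on_span[of "(*v) D" "v ` {..<CARD('q)}" x] assms(2) by auto
  then show ?thesis
    by (simp add: matrix_eq)
qed

lemma svd_sum_mult_vector:
  assumes "orthonormal_family k v" "i < k"
  shows "(\<Sum>j<k. s j *\<^sub>R outer (u j) (v j)) *v v i = s i *\<^sub>R u i"
proof -
  have "(\<Sum>j<k. s j *\<^sub>R outer (u j) (v j)) *v v i = (\<Sum>j<k. if j = i then s i *\<^sub>R u i else 0)"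
    unfolding sum_matrix_vector_mult
    using assms by (intro sum.cong)
      (auto simp: orthonormal_family_def outer_mult_vector simp flip: scaleR_matrix_vector_assoc)
  then show ?thesis using assms by simp
qed

lemma transpose_svd_sum:
  "transpose (\<Sum>j<k. s j *\<^sub>R outer (u j) (v j)) = (\<Sum>j<k. s j *\<^sub>R outer (v j) (u j))"
  by (simp add: linear_sum[OF linear_transpose] linear_cmul[OF linear_transpose] transpose_outer)

lemma svd_exists: "\<exists>u s v. is_svd (max_rank X) X u s v" for X :: "real^'q^'p"
proof -
  obtain u s v where *: "orthonormal_family (max_rank X) u" "orthonormal_family (max_rank X) v"
     "\<forall>i<max_rank X. 0 \<le> s i" "\<forall>i j. i \<le> j \<longrightarrow> j < max_rank X \<longrightarrow> s j \<le> s i"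
     "\<forall>i<max_rank X. X *v v i = s i *\<^sub>R u i" "\<forall>i<max_rank X. transpose X *v u i = s i *\<^sub>R v i"
    using partial_svd_exists[of "max_rank X" X] unfolding max_rank_def by blast
  define D where "D = X - (\<Sum>j<max_rank X. s j *\<^sub>R outer (u j) (v j))"
  have Dv: "D *v v i = 0" if "i < max_rank X" for i
    using that * by (simp add: D_def matrix_vector_mult_diff_rdistrib svd_sum_mult_vector)
  have Du: "transpose D *v u i = 0" if "i < max_rank X" for i
    using that * by (simp add: D_def matrix_vector_mult_diff_rdistrib svd_sum_mult_vector
        linear_diff[OF linear_transpose] transpose_svd_sum)
  \<comment> \<open>\<open>max_rank X\<close> is the smaller dimension, so one of the two families
    is a full orthonormal basis. The residual is tested on that side: \<open>D\<close> on the
    \<open>v i\<close>, or its transpose on the \<open>u i\<close>.\<close>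
  have "D = 0"
  proof (cases "CARD('q) \<le> CARD('p)")
    case True
    then have "max_rank X = CARD('q)"
      by (simp add: max_rank_def)
    then show ?thesis
      using matrix_eq_0_if_zero_on_basis[of v D] *(2) Dv by simp
  next
    case False
    then have "max_rank X = CARD('p)"
      by (simp add: max_rank_def)
    then have "transpose D = 0"
      using matrix_eq_0_if_zero_on_basis[of u "transpose D"] *(1) Du by simp
    then show ?thesis
      by (metis norm_transpose norm_eq_zero)
  qed
  then show ?thesis
    using * by (intro exI[of _ u] exI[of _ s] exI[of _ v]) (simp add: is_svd_def D_def)
qed

section \<open>Eckart--Young theorem and best low-rank approximation\<close>

lemma weighted_sum_le_top_sum:
  fixes c w :: "nat \<Rightarrow> real"
  assumes c: "\<And>i. i < m \<Longrightarrow> 0 \<le> c i" "\<And>i j. i \<le> j \<Longrightarrow> j < m \<Longrightarrow> c j \<le> c i"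
    and w: "\<And>i. i < m \<Longrightarrow> 0 \<le> w i" "\<And>i. i < m \<Longrightarrow> w i \<le> 1" "(\<Sum>i<m. w i) \<le> real r"
  shows "(\<Sum>i<m. c i * w i) \<le> (\<Sum>i<min r m. c i)"
proof (cases "r < m")
  case False
  then have "min r m = m" by simp
  then show ?thesis
    using c(1) w(2) by (auto intro!: sum_mono mult_left_le)
next
  case True
  \<comment> \<open>The threshold \<open>c r\<close> is, by zero-based indexing, the value just
    after the \<open>r\<close> largest. The excess of each of the first \<open>r\<close> values over
    it is counted with weight 1; the rest costs at most \<open>c r\<close> per unit of weight, and
    the total weight is at most \<open>r\<close>.\<close>
  have "(\<Sum>i<m. c i * w i) \<le> (\<Sum>i<m. c r * w i + (if i < r then c i - c r else 0))"
  proof (rule sum_mono)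
    fix i assume "i \<in> {..<m}"
    then have i: "i < m" by simp
    show "c i * w i \<le> c r * w i + (if i < r then c i - c r else 0)"
    proof (cases "i < r")
      case True
      then have "(c i - c r) * w i \<le> c i - c r"
        using c(2)[of i r] \<open>r < m\<close> w(2)[OF i] by (intro mult_left_le) auto
      then show ?thesis
        using True by (simp add: algebra_simps)
    next
      case False
      then show ?thesis
        using c(2)[of r i] i w(1)[OF i] by (simp add: mult_right_mono)
    qed
  qed
  also have "\<dots> = c r * (\<Sum>i<m. w i) + (\<Sum>i<r. c i - c r)"
  proof -
    have "{..<m} \<inter> {i. i < r} = {..<r}"
      using True by auto
    then show ?thesis
      by (simp add: sum.distrib sum_distrib_left sum.If_cases)
  qed
  also have "\<dots> \<le> c r * real r + (\<Sum>i<r. c i - c r)"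
    using mult_left_mono[OF w(3) c(1)[OF True]] by simp
  also have "\<dots> = (\<Sum>i<min r m. c i)"
    using True by (simp add: sum_subtractf algebra_simps)
  finally show ?thesis .
qed

lemma norm_orthonormal: "orthonormal_family k u \<Longrightarrow> i < k \<Longrightarrow> norm (u i) = 1"
  by (simp add: orthonormal_family_def norm_eq_1)

text \<open>Eckart--Young: projecting onto the column space of \<open>B\<close> can only capture as much of the norm
  of \<open>Z\<close> as its \<open>r\<close> largest singular values contain.\<close>

lemma truncated_svd_best_approx:
  fixes Z :: "real^'q^'p"
  assumes "is_truncated_svd r Z Y" and "rank B \<le> r"
  shows "norm (Z - Y) \<le> norm (Z - B)"
proof -
  define m where "m = max_rank Z"
  obtain u s v where svd: "is_svd m Z u s v" and Y: "Y = (\<Sum>i<min r m. s i *\<^sub>R outer (u i) (v i))"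
    using assms(1) by (auto simp: is_truncated_svd_def m_def)
  have on: "orthonormal_family m u" "orthonormal_family m v"
    and s: "\<And>i. i < m \<Longrightarrow> 0 \<le> s i" "\<And>i j. i \<le> j \<Longrightarrow> j < m \<Longrightarrow> s j \<le> s i"
    and Z: "Z = (\<Sum>i<m. s i *\<^sub>R outer (u i) (v i))"
    using svd by (auto simp: is_svd_def)
  define d where "d = dim (range ((*v) B))"
  obtain e where e: "orthonormal_family d e" "span (e ` {..<d}) = range ((*v) B)"
    using obtain_orthonormal_family[of "range ((*v) B)"] unfolding d_def
    by (metis linear_subspace_image matrix_vector_mul_linear subspace_UNIV)
  have d: "d \<le> r"
    using assms(2) by (simp add: d_def rank_dim_range)
  define Q where "Q = frame_proj d e"
  have Q: "transpose Q = Q" "Q ** Q = Q"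
    using e(1) by (simp_all add: Q_def transpose_frame_proj frame_proj_idem)
  have QB: "Q ** B = B"
    using frame_proj_mult_span[OF e(1)] e(2)
    by (simp add: matrix_eq Q_def flip: matrix_vector_mul_assoc)
  have w: "(norm (Q *v x))\<^sup>2 = (\<Sum>j<d. (e j \<bullet> x)\<^sup>2)" for x
  proof -
    have "(norm (Q *v x))\<^sup>2 = (Q *v x) \<bullet> x"
      by (metis Q inner_matrix_vector_mult matrix_vector_mul_assoc power2_norm_eq_inner inner_commute)
    then show ?thesis
      by (simp add: Q_def frame_proj_mult_vector inner_sum_left power2_eq_square)
  qed
  \<comment> \<open>The weights \<open>(norm (Q *v u i))\<^sup>2\<close> measure how much of each
    singular direction lies in the range of \<open>B\<close>. Bessel for the \<open>e j\<close>
    bounds each by 1; after exchanging the sums, Bessel for the \<open>u i\<close> bounds their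
    total by \<open>d\<close>.\<close>
  have "(norm (Q ** Z))\<^sup>2 = (\<Sum>i<m. (s i)\<^sup>2 * (norm (Q *v u i))\<^sup>2)"
    unfolding norm_power2_sum_outer[OF on(2), symmetric]
    by (simp add: Z matrix_mult_sum_right matrix_mult_scaleR_right matrix_mult_outer)
  also have "\<dots> \<le> (\<Sum>i<min r m. (s i)\<^sup>2)"
  proof (rule weighted_sum_le_top_sum)
    show "(s j)\<^sup>2 \<le> (s i)\<^sup>2" if "i \<le> j" "j < m" for i j
      using s that by (simp add: power_mono)
    show "(norm (Q *v u i))\<^sup>2 \<le> 1" if "i < m" for i
      using bessel_inequality[OF e(1), of "u i"] norm_orthonormal[OF on(1) that] by (simp add: w)
    have "(\<Sum>i<m. (norm (Q *v u i))\<^sup>2) = (\<Sum>j<d. \<Sum>i<m. (u i \<bullet> e j)\<^sup>2)"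
      by (subst sum.swap) (simp add: w inner_commute)
    also have "\<dots> \<le> (\<Sum>j<d. (norm (e j))\<^sup>2)"
      by (intro sum_mono bessel_inequality on)
    also have "\<dots> = real d"
      using norm_orthonormal[OF e(1)] by simp
    finally show "(\<Sum>i<m. (norm (Q *v u i))\<^sup>2) \<le> real r"
      using d by simp
  qed auto
  finally have QZ: "(norm (Q ** Z))\<^sup>2 \<le> (\<Sum>i<min r m. (s i)\<^sup>2)" .
  have sum_min: "(\<Sum>i<min r m. f i) = (\<Sum>i<m. if i < r then f i else 0)"
    for f :: "nat \<Rightarrow> 'b::real_vector"
    by (rule sum.mono_neutral_cong_left) auto
  have "Z - Y = (\<Sum>i<m. (if i < r then 0 else s i) *\<^sub>R outer (u i) (v i))"
    unfolding Y sum_min unfolding Z sum_subtractf[symmetric] by (intro sum.cong) auto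
  then have "(norm (Z - Y))\<^sup>2 = (\<Sum>i<m. (if i < r then 0 else s i)\<^sup>2 * (norm (u i))\<^sup>2)"
    by (simp only: norm_power2_sum_outer[OF on(2)])
  also have "\<dots> = (\<Sum>i<m. (s i)\<^sup>2 * (norm (u i))\<^sup>2 - (if i < r then (s i)\<^sup>2 else 0))"
    using norm_orthonormal[OF on(1)] by (intro sum.cong) auto
  also have "\<dots> = (norm Z)\<^sup>2 - (\<Sum>i<min r m. (s i)\<^sup>2)"
    unfolding sum_min sum_subtractf by (simp add: Z norm_power2_sum_outer[OF on(2)])
  also have "\<dots> \<le> (norm Z)\<^sup>2 - (norm (Q ** Z))\<^sup>2"
    using QZ by simp
  also have "\<dots> = (norm ((mat 1 - Q) ** Z))\<^sup>2"
    using norm_power2_split_proj[OF Q, of Z] by simp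
  \<comment> \<open>\<open>Q\<close> fixes \<open>B\<close>, so the complementary projection
    annihilates \<open>B\<close>; here the competitor enters the estimate.\<close>
  also have "(mat 1 - Q) ** Z = (mat 1 - Q) ** (Z - B)"
    by (simp add: matrix_mult_diff_left matrix_mult_diff_right QB)
  also have "(norm \<dots>)\<^sup>2 \<le> (norm (Z - B))\<^sup>2"
    by (intro power_mono norm_proj_mult_le Q) simp
  finally show ?thesis
    by (rule power2_le_imp_le) simp
qed

lemma rank_truncated_svd_le:
  assumes "is_truncated_svd r Z Y" shows "rank Y \<le> r"
proof -
  obtain u s v where "Y = (\<Sum>i<min r (max_rank Z). s i *\<^sub>R outer (u i) (v i))"
    using assms by (auto simp: is_truncated_svd_def)
  then show ?thesis
    using rank_sum_outer_le[of "{..<min r (max_rank Z)}" s u v] by simp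
qed

text \<open>The rank constraint is invariant under scaling, so any competitor \<open>W\<close> may
  be rescaled optimally before comparison with the minimizer \<open>B\<close>. The choice
  \<open>W = B\<close> yields \<open>B \<bullet> D = (norm B)\<^sup>2\<close>, and then
  \<open>W = Z\<close> yields the claim. It sharpens Cauchy--Schwarz so that only the low-rank part
  of the noise counts.\<close>

lemma inner_le_norm_best_rank_approx:
  fixes D Z :: "real^'q^'p"
  assumes "rank Z \<le> r"
  shows "Z \<bullet> D \<le> norm Z * norm (best_rank_approx r D)"
proof -
  define B where "B = best_rank_approx r D"
  \<comment> \<open>The choice in \<open>best_rank_approx\<close> says something only once a
    minimizer exists; a truncated SVD is one.\<close>
  obtain Y where "is_truncated_svd r D Y"
    using svd_exists[of D] by (auto simp: is_truncated_svd_def)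
  then have "is_arg_min (\<lambda>Y. norm (D - Y)) (\<lambda>Y. rank Y \<le> r) Y"
    using truncated_svd_best_approx rank_truncated_svd_le by (auto simp: is_arg_min_linorder)
  then have "is_arg_min (\<lambda>Y. norm (D - Y)) (\<lambda>Y. rank Y \<le> r) B"
    unfolding B_def best_rank_approx_def arg_min_def by (rule someI)
  then have B: "rank B \<le> r" "\<And>Y. rank Y \<le> r \<Longrightarrow> norm (D - B) \<le> norm (D - Y)"
    by (auto simp: is_arg_min_linorder)
  have key: "(norm (D - B))\<^sup>2 \<le> (norm D)\<^sup>2 - (W \<bullet> D)\<^sup>2 / (norm W)\<^sup>2" if "rank W \<le> r" for W
  proof -
    let ?c = "(W \<bullet> D) / (norm W)\<^sup>2"
    have "(norm (D - B))\<^sup>2 \<le> (norm (D - ?c *\<^sub>R W))\<^sup>2"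
      using that rank_scaleR_le[of ?c W] by (intro power_mono B) auto
    also have "\<dots> = (norm D)\<^sup>2 - 2 * ?c * (W \<bullet> D) + ?c\<^sup>2 * (norm W)\<^sup>2"
      unfolding power2_norm_eq_inner
      by (simp add: inner_diff inner_commute power2_eq_square[of "_ / _"])
    also have "\<dots> = (norm D)\<^sup>2 - (W \<bullet> D)\<^sup>2 / (norm W)\<^sup>2"
      by (cases "W = 0") (simp_all add: field_simps power2_eq_square)
    finally show ?thesis .
  qed
  have exp: "(norm (D - B))\<^sup>2 = (norm D)\<^sup>2 - 2 * (B \<bullet> D) + (norm B)\<^sup>2"
    by (simp add: power2_norm_eq_inner inner_diff inner_commute)
  have BD: "B \<bullet> D = (norm B)\<^sup>2"
  proof (cases "B = 0")
    case False
    have "(norm B)\<^sup>2 - 2 * (B \<bullet> D) + (B \<bullet> D)\<^sup>2 / (norm B)\<^sup>2 \<le> 0"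
      using key[OF B(1)] exp by simp
    then have "((norm B)\<^sup>2 - B \<bullet> D)\<^sup>2 / (norm B)\<^sup>2 \<le> 0"
      using False by (simp add: field_simps power2_eq_square)
    then show ?thesis
      using False by (simp add: divide_le_0_iff)
  qed simp
  show ?thesis
  proof (cases "Z = 0")
    case False
    have "(Z \<bullet> D)\<^sup>2 / (norm Z)\<^sup>2 \<le> (norm B)\<^sup>2"
      using key[OF assms] exp BD by simp
    then have "(Z \<bullet> D)\<^sup>2 \<le> (norm Z * norm B)\<^sup>2"
      using False by (simp add: field_simps)
    then show ?thesis
      unfolding B_def by (rule power2_le_imp_le) simp
  qed simp
qed

text \<open>Removes \<open>\<eta>\<close> in the noiseless case: zero is a competitor with error
  zero, so whichever minimizer is chosen must vanish.\<close>

lemma best_rank_approx_0: "best_rank_approx r (0 :: real^'q^'p) = 0"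
proof -
  have "is_arg_min (\<lambda>Y. norm ((0 :: real^'q^'p) - Y)) (\<lambda>Y. rank Y \<le> r) 0"
    by (auto simp: is_arg_min_linorder)
  then have "is_arg_min (\<lambda>Y. norm ((0 :: real^'q^'p) - Y)) (\<lambda>Y. rank Y \<le> r) (best_rank_approx r 0)"
    unfolding best_rank_approx_def arg_min_def by (rule someI)
  then show ?thesis
    by (auto simp: is_arg_min_linorder dest: spec[of _ 0])
qed

section \<open>Smallest positive singular value and pseudoinverse\<close>

lemma svd_positive_iff_lt_rank:
  fixes X :: "real^'q^'p"
  assumes "is_svd m X u s v" "i < m"
  shows "0 < s i \<longleftrightarrow> i < rank X"
proof -
  have on: "orthonormal_family m u" "orthonormal_family m v"
    and s: "\<And>i. i < m \<Longrightarrow> 0 \<le> s i" "\<And>i j. i \<le> j \<Longrightarrow> j < m \<Longrightarrow> s j \<le> s i"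
    and X: "X = (\<Sum>i<m. s i *\<^sub>R outer (u i) (v i))"
    using assms(1) by (auto simp: is_svd_def)
  show ?thesis
  proof
    assume pos: "0 < s i"
    have "Suc i \<le> dim (range ((*v) X))"
    proof (rule orthonormal_family_card_le_dim)
      show "orthonormal_family (Suc i) u"
        using on(1) assms(2) by (simp add: orthonormal_family_def)
      fix j assume "j < Suc i"
      then have j: "j < m" "0 < s j"
        using assms(2) s(2)[of j i] pos by auto
      then have "X *v ((1 / s j) *\<^sub>R v j) = u j"
        using svd_sum_mult_vector[OF on(2), of j s u] X by (simp add: matrix_vector_mult_scaleR)
      then show "u j \<in> range ((*v) X)"
        by (metis rangeI)
    qed
    then show "i < rank X"
      by (simp add: rank_dim_range)
  next
    assume lt: "i < rank X"
    show "0 < s i"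
    proof (rule ccontr)
      assume "\<not> 0 < s i"
      \<comment> \<open>By the ordering all later singular values vanish too, which leaves only
        \<open>i\<close> rank-one terms.\<close>
      then have "s j = 0" if "i \<le> j" "j < m" for j
        using s that assms(2) by (smt (verit))
      then have "X = (\<Sum>j<i. s j *\<^sub>R outer (u j) (v j))"
        unfolding X using assms(2) by (intro sum.mono_neutral_right) auto
      then have "rank X \<le> i"
        using rank_sum_outer_le[of "{..<i}" s u v] by simp
      with lt show False by simp
    qed
  qed
qed

text \<open>\<open>M\<close> is the Moore--Penrose inverse, whose operator norm is
  \<open>1 / \<sigma>\<close>. Multiplication by it from the right therefore costs the Frobenius
  norm only this factor, which is where \<open>\<sigma>\<close> comes from in the tangent residual
  bound.\<close>

lemma pseudoinverse_exists:
  fixes X :: "real^'q^'p"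
  assumes "1 \<le> rank X"
  defines "\<sigma> \<equiv> singular_value (rank X) X"
  obtains M where "0 < \<sigma>" "X ** M ** X = X"
    "\<And>Y :: real^'q^'p. norm (Y ** M) \<le> norm Y / \<sigma>"
proof -
  define k where "k = rank X"
  \<comment> \<open>An SVD realizing the value selected by \<open>singular_value\<close> is
    recovered and used throughout. Its values are indexed from 0, hence
    \<open>k - 1\<close>.\<close>
  have "\<exists>\<sigma> u s v. is_svd (max_rank X) X u s v \<and> \<sigma> = s (k - 1)"
    using svd_exists by blast
  then have "\<exists>u s v. is_svd (max_rank X) X u s v \<and> \<sigma> = s (k - 1)"
    unfolding \<sigma>_def singular_value_def k_def by (rule someI_ex)
  then obtain u s v where svd: "is_svd (max_rank X) X u s v" and \<sigma>: "\<sigma> = s (k - 1)"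
    by blast
  have k: "1 \<le> k" "k \<le> max_rank X"
    using assms(1) rank_bound[of X] by (auto simp: k_def max_rank_def)
  have pos: "0 < s i \<longleftrightarrow> i < k" if "i < max_rank X" for i
    using svd_positive_iff_lt_rank[OF svd that] by (simp add: k_def)
  have on: "orthonormal_family k u" "orthonormal_family k v"
    and s: "\<And>i. i < max_rank X \<Longrightarrow> 0 \<le> s i" "\<And>i j. i \<le> j \<Longrightarrow> j < max_rank X \<Longrightarrow> s j \<le> s i"
    and X: "X = (\<Sum>i<max_rank X. s i *\<^sub>R outer (u i) (v i))"
    using svd k by (auto simp: is_svd_def orthonormal_family_def)
  have "\<sigma> > 0"
    using pos[of "k - 1"] k \<sigma> by simp
  have ge: "\<sigma> \<le> s i" if "i < k" for i
    using s(2)[of i "k - 1"] that k \<sigma> by simp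
  have "s i = 0" if "k \<le> i" "i < max_rank X" for i
    using s(1) pos that by (metis linorder_not_less order_antisym_conv)
  then have zero: "s i = 0" if "i < max_rank X" "\<not> i < k" for i
    using that by simp
  have Xk: "X = (\<Sum>i<k. s i *\<^sub>R outer (u i) (v i))"
    by (subst X, rule sum.mono_neutral_right) (use k zero in auto)
  define M where "M = (\<Sum>i<k. (1 / s i) *\<^sub>R outer (v i) (u i))"
  show thesis
  proof (rule that)
    have "X *v v i = s i *\<^sub>R u i" if "i < k" for i
      using svd_sum_mult_vector[OF on(2) that, of s u] Xk by simp
    then have "X ** M = (\<Sum>i<k. outer (u i) (u i))"
      unfolding M_def matrix_mult_sum_right matrix_mult_scaleR_right matrix_mult_outer
      using ge \<open>\<sigma> > 0\<close> by (intro sum.cong) (force simp: outer_def vec_eq_iff)+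
    then have XM: "X ** M = frame_proj k u"
      by (simp add: frame_proj_def)
    show "X ** M ** X = X"
      unfolding XM
      by (subst (1 2) Xk) (simp add: matrix_mult_sum_right matrix_mult_scaleR_right
          matrix_mult_outer frame_proj_mult_member[OF on(1)])
    fix Y :: "real^'q^'p"
    have "(norm (Y ** M))\<^sup>2 = (\<Sum>i<k. (1 / s i)\<^sup>2 * (norm (Y *v v i))\<^sup>2)"
      unfolding norm_power2_sum_outer[OF on(1), symmetric]
      by (simp add: M_def matrix_mult_sum_right matrix_mult_scaleR_right matrix_mult_outer)
    also have "\<dots> \<le> (\<Sum>i<k. (1 / \<sigma>)\<^sup>2 * (norm (Y *v v i))\<^sup>2)"
    proof (intro sum_mono mult_right_mono power_mono)
      fix i assume "i \<in> {..<k}"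
      then have "\<sigma> \<le> s i"
        using ge by simp
      then show "1 / s i \<le> 1 / \<sigma>" "0 \<le> 1 / s i"
        using \<open>\<sigma> > 0\<close> by (simp_all add: frac_le)
    qed simp
    also have "\<dots> \<le> (1 / \<sigma>)\<^sup>2 * (norm Y)\<^sup>2"
      unfolding sum_distrib_left[symmetric]
      by (intro mult_left_mono bessel_inequality_matrix on) simp
    also have "\<dots> = (norm Y / \<sigma>)\<^sup>2"
      by (simp add: power_divide)
    finally show "norm (Y ** M) \<le> norm Y / \<sigma>"
      by (rule power2_le_imp_le) (use \<open>\<sigma> > 0\<close> in simp)
  qed (fact \<open>\<sigma> > 0\<close>)
qed

section \<open>Tangent space projections\<close>

text \<open>The normal part is a single two-sided product of complementary projectors. Idempotence,
  self-adjointness and the residual bounds are read off this form.\<close>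

lemma tangent_proj_eq:
  "tangent_proj k u v Z = Z - (mat 1 - frame_proj k u) ** Z ** (mat 1 - frame_proj k v)"
  by (simp add: tangent_proj_def Let_def matrix_mult_diff_left matrix_mult_diff_right)

lemma svd_frame_proj:
  assumes "is_svd k X u s v"
  shows "frame_proj k u ** X = X" "X ** frame_proj k v = X"
proof -
  have on: "orthonormal_family k u" "orthonormal_family k v"
    and X: "X = (\<Sum>i<k. s i *\<^sub>R outer (u i) (v i))"
    using assms by (auto simp: is_svd_def)
  show "frame_proj k u ** X = X"
    by (subst (1 2) X) (simp add: matrix_mult_sum_right matrix_mult_scaleR_right
        matrix_mult_outer frame_proj_mult_member[OF on(1)])
  have "outer (u i) (v i) ** frame_proj k v = outer (u i) (v i)" if "i < k" for i
    using frame_proj_mult_member[OF on(2) that]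
    by (simp only: outer_mult_matrix transpose_frame_proj)
  then show "X ** frame_proj k v = X"
    by (subst (1 2) X) (simp add: matrix_mult_sum_left matrix_mult_scaleR_left)
qed

context
  fixes r :: nat and X :: "real^'q^'p" and P
  assumes tangent: "is_tangent_proj r X P"
begin

lemma linear_tangent_proj: "linear P"
proof -
  obtain u v where P: "P = tangent_proj r u v"
    using tangent by (auto simp: is_tangent_proj_def)
  show ?thesis
    unfolding P tangent_proj_def Let_def
    by (intro linearI) (simp_all add: matrix_add_ldistrib bilinear_ladd[OF bilinear_matrix_mult]
        matrix_mult_scaleR_left matrix_mult_scaleR_right scaleR_add_right)
qed

lemma tangent_proj_idem: "P (P Z) = P Z"
proof -
  obtain u s v where svd: "is_svd r X u s v" and P: "P = tangent_proj r u v"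
    using tangent by (auto simp: is_tangent_proj_def)
  define U V where "U = mat 1 - frame_proj r u" and "V = mat 1 - frame_proj r v"
  have on: "orthonormal_family r u" "orthonormal_family r v"
    using svd by (auto simp: is_svd_def)
  have "U ** U = U" "V ** V = V"
    using frame_proj_idem[OF on(1)] frame_proj_idem[OF on(2)]
    by (simp_all add: U_def V_def matrix_mult_diff_left matrix_mult_diff_right)
  then have "U ** (U ** Z ** V) ** V = U ** Z ** V"
    by (metis matrix_mul_assoc)
  then have "U ** (Z - U ** Z ** V) ** V = 0"
    by (simp add: matrix_mult_diff_right matrix_mult_diff_left)
  then show ?thesis
    unfolding P tangent_proj_eq U_def V_def by simp
qed

lemma tangent_proj_self_adjoint: "P Z \<bullet> W = Z \<bullet> P W"
proof -
  obtain u v where P: "P = tangent_proj r u v"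
    using tangent by (auto simp: is_tangent_proj_def)
  let ?U = "mat 1 - frame_proj r u" and ?V = "mat 1 - frame_proj r v"
  have tr: "transpose ?U = ?U" "transpose ?V = ?V"
    by (simp_all add: linear_diff[OF linear_transpose] transpose_frame_proj)
  have "(?U ** Z ** ?V) \<bullet> W = Z \<bullet> (?U ** W ** ?V)"
    by (subst inner_matrix_mult_right, subst inner_matrix_mult_left)
      (simp only: tr matrix_mul_assoc)
  then show ?thesis
    unfolding P tangent_proj_eq by (simp add: inner_diff)
qed

lemma tangent_proj_base: "P X = X"
proof -
  obtain u s v where svd: "is_svd r X u s v" and P: "P = tangent_proj r u v"
    using tangent by (auto simp: is_tangent_proj_def)
  show ?thesis
    unfolding P tangent_proj_eq
    by (simp add: matrix_mult_diff_left svd_frame_proj[OF svd] matrix_mult_zero_left)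
qed

lemma rank_tangent_proj_le: "rank (P Z) \<le> 2 * r"
proof -
  obtain u v where P: "P = tangent_proj r u v"
    using tangent by (auto simp: is_tangent_proj_def)
  \<comment> \<open>Regrouped into two products, one with a factor of rank at most \<open>r\<close>
    on the left and one with such a factor on the right; bounding the three defining terms
    separately would give only \<open>3 * r\<close>.\<close>
  have "P Z = frame_proj r u ** Z + ((mat 1 - frame_proj r u) ** Z) ** frame_proj r v"
    unfolding P tangent_proj_eq by (simp add: matrix_mult_diff_left matrix_mult_diff_right)
  then have "rank (P Z) \<le> rank (frame_proj r u) + rank (frame_proj r v)"
    using rank_add_le rank_mul_le_left rank_mul_le_right
    by (smt (verit) add_mono le_trans)
  then show ?thesis
    using rank_frame_proj_le[of r u] rank_frame_proj_le[of r v] by linarith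
qed

lemma rank_tangent_residual_le: "rank (Z - P Z) \<le> rank Z"
proof -
  obtain u v where P: "P = tangent_proj r u v"
    using tangent by (auto simp: is_tangent_proj_def)
  show ?thesis
    unfolding P tangent_proj_eq
    by simp (meson le_trans rank_mul_le_left rank_mul_le_right)
qed

lemma norm_tangent_proj_le: "norm (P Z) \<le> norm Z"
proof -
  have "P Z \<bullet> P Z = P Z \<bullet> Z"
    by (metis tangent_proj_idem tangent_proj_self_adjoint inner_commute)
  then have "norm (P Z) * norm (P Z) \<le> norm (P Z) * norm Z"
    by (metis norm_cauchy_schwarz power2_eq_square power2_norm_eq_inner)
  then show ?thesis
    by (cases "P Z = 0") auto
qed

text \<open>With a pseudoinverse \<open>M\<close> of \<open>Y\<close> and the complementary projections \<open>U\<close>, \<open>V\<close>, the residual is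
  \<open>U Y V = U Y M Y V = U (Y - X) M (Y - X) V\<close>, hence quadratic in \<open>Y - X\<close>.\<close>

lemma norm_tangent_residual_le:
  assumes "1 \<le> rank Y"
  shows "norm (Y - P Y) \<le> (norm (X - Y))\<^sup>2 / singular_value (rank Y) Y"
proof -
  obtain u s v where svd: "is_svd r X u s v" and P: "P = tangent_proj r u v"
    using tangent by (auto simp: is_tangent_proj_def)
  let ?\<sigma> = "singular_value (rank Y) Y"
  let ?U = "mat 1 - frame_proj r u" and ?V = "mat 1 - frame_proj r v"
  have on: "orthonormal_family r u" "orthonormal_family r v"
    using svd by (auto simp: is_svd_def)
  obtain M where \<sigma>: "0 < ?\<sigma>" and M: "Y ** M ** Y = Y"
    "\<And>Z :: real^'q^'p. norm (Z ** M) \<le> norm Z / ?\<sigma>"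
    using pseudoinverse_exists[OF assms] by metis
  have UX: "?U ** (Y - X) = ?U ** Y" "(Y - X) ** ?V = Y ** ?V"
    by (simp_all add: matrix_mult_diff_left matrix_mult_diff_right svd_frame_proj[OF svd])
  have "Y - P Y = ?U ** Y ** ?V"
    unfolding P by (simp add: tangent_proj_eq)
  also have "\<dots> = ?U ** (Y ** M ** Y) ** ?V"
    by (simp only: M(1))
  also have "\<dots> = (?U ** Y ** M) ** (Y ** ?V)"
    by (simp only: matrix_mul_assoc)
  also have "\<dots> = (?U ** (Y - X) ** M) ** ((Y - X) ** ?V)"
    by (simp only: UX)
  finally have "norm (Y - P Y) \<le> norm (?U ** (Y - X) ** M) * norm ((Y - X) ** ?V)"
    by (simp only: norm_matrix_mult_le)
  also have "\<dots> \<le> (norm (?U ** (Y - X)) / ?\<sigma>) * norm (Y - X)"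
    using \<sigma> by (intro mult_mono M norm_mult_proj_le frame_proj_idem transpose_frame_proj on) simp_all
  also have "\<dots> \<le> (norm (Y - X) / ?\<sigma>) * norm (Y - X)"
    using \<sigma> by (intro mult_right_mono divide_right_mono norm_proj_mult_le frame_proj_idem
        transpose_frame_proj on) simp_all
  finally show ?thesis
    by (simp add: power2_eq_square norm_minus_commute)
qed

end

section \<open>Restricted isometries\<close>

lemma linear_meas_op: "linear (meas_op A)"
  by (auto intro!: linearI simp: meas_op_def inner_add_right vec_eq_iff)

lemma inner_adjoint_meas_op: "Z \<bullet> adjoint (meas_op A) y = meas_op A Z \<bullet> y"
  by (rule adjoint_works[OF linear_meas_op])

text \<open>\<open>LEAST\<close> over the reals carries no information unless the minimum is
  attained. The admissible constants form a set that is nonempty because the operator is bounded,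
  closed as an intersection of half-lines, and bounded below by 0.\<close>

lemma ric_attained:
  fixes A :: "'n::finite \<Rightarrow> real^'q^'p"
  assumes "1 \<le> s"
  defines "S \<equiv> {R. \<forall>Z. rank Z \<le> s \<longrightarrow>
     (1 - R) * (norm Z)\<^sup>2 \<le> (norm (meas_op A Z))\<^sup>2 \<and>
     (norm (meas_op A Z))\<^sup>2 \<le> (1 + R) * (norm Z)\<^sup>2}"
  shows "ric A s \<in> S" and "\<And>R. R \<in> S \<Longrightarrow> ric A s \<le> R"
proof -
  obtain K where K: "\<And>Z. norm (meas_op A Z) \<le> K * norm Z"
    using linear_bounded[OF linear_meas_op] by blast
  \<comment> \<open>This constant makes the lower bound trivial, its left side being nonpositive,
    and leaves room in the upper one.\<close>
  have "1 + K\<^sup>2 \<in> S"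
  proof -
    have "(norm (meas_op A Z))\<^sup>2 \<le> K\<^sup>2 * (norm Z)\<^sup>2" for Z
      using power_mono[OF K[of Z], of 2] by (simp add: power_mult_distrib)
    then have "(norm (meas_op A Z))\<^sup>2 \<le> (1 + (1 + K\<^sup>2)) * (norm Z)\<^sup>2" for Z
      by (rule order_trans) (simp add: mult_right_mono)
    moreover have "(1 - (1 + K\<^sup>2)) * (norm Z)\<^sup>2 \<le> (norm (meas_op A Z))\<^sup>2" for Z
      by (rule order_trans[of _ 0]) (simp_all add: mult_nonpos_nonneg)
    ultimately show ?thesis
      by (simp add: S_def)
  qed
  then have ne: "S \<noteq> {}" by auto
  \<comment> \<open>A unit matrix of rank one turns the two inequalities into
    \<open>1 - R \<le> 1 + R\<close>.\<close>
  obtain a :: "real^'p" where "norm a = 1"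
    using vector_choose_size[of 1] by auto
  obtain b :: "real^'q" where "norm b = 1"
    using vector_choose_size[of 1] by auto
  define E where "E = outer a b"
  have "E \<bullet> E = 1"
    using \<open>norm a = 1\<close> \<open>norm b = 1\<close> by (simp add: E_def inner_outer_outer norm_eq_1)
  then have E: "norm E = 1" "rank E \<le> s"
    using rank_outer_le[of a b] assms(1) by (auto simp: norm_eq_1 E_def)
  have "0 \<le> R" if "R \<in> S" for R
  proof -
    have "(1 - R) * (norm E)\<^sup>2 \<le> (1 + R) * (norm E)\<^sup>2"
      using that E(2) unfolding S_def by (blast intro: order_trans)
    then show ?thesis
      using E(1) by simp
  qed
  then have bdd: "bdd_below S"
    by (auto simp: bdd_below_def)
  have "S = (\<Inter>Z\<in>{Z. rank Z \<le> s}. {R. (1 - R) * (norm Z)\<^sup>2 \<le> (norm (meas_op A Z))\<^sup>2} \<inter>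
      {R. (norm (meas_op A Z))\<^sup>2 \<le> (1 + R) * (norm Z)\<^sup>2})"
    by (auto simp: S_def)
  also have "closed \<dots>"
    by (intro closed_INT ballI closed_Int closed_Collect_le continuous_intros)
  finally have "Inf S \<in> S"
    using closed_contains_Inf[OF ne bdd] by blast
  moreover have "ric A s = (LEAST R. R \<in> S)"
    by (simp add: ric_def S_def)
  moreover have "Inf S \<le> R" if "R \<in> S" for R
    using that bdd by (rule cInf_lower)
  ultimately have "ric A s = Inf S"
    by (simp add: Least_equality)
  then show "ric A s \<in> S" "\<And>R. R \<in> S \<Longrightarrow> ric A s \<le> R"
    using \<open>Inf S \<in> S\<close> bdd by (simp_all add: cInf_lower)
qed

lemma ric_bounds:
  assumes "1 \<le> s" "rank Z \<le> s"
  shows "(1 - ric A s) * (norm Z)\<^sup>2 \<le> (norm (meas_op A Z))\<^sup>2"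
    "(norm (meas_op A Z))\<^sup>2 \<le> (1 + ric A s) * (norm Z)\<^sup>2"
  using ric_attained(1)[OF assms(1), of A] assms(2) by auto

lemma ric_mono:
  assumes "1 \<le> s" "s \<le> s'" shows "ric A s \<le> ric A s'"
  using ric_bounds[of s' _ A] assms by (intro ric_attained(2)) auto

text \<open>Polarization after \<open>x\<close> and \<open>y\<close> are rescaled to equal norm:
  \<open>4 * (n * B x y) = B p p - B q q\<close>, and by the parallelogram law the squared norms of
  \<open>p\<close> and \<open>q\<close> add up to \<open>4 * n\<^sup>2\<close>. The quadratic bound
  is asked only on the span of \<open>x\<close> and \<open>y\<close>, where the rank stays
  controlled.\<close>

lemma symmetric_form_bound:
  fixes B :: "'a::real_inner \<Rightarrow> 'a \<Rightarrow> real"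
  assumes bil: "bilinear B" and sym: "B x y = B y x"
    and bound: "\<And>a b. \<bar>B (a *\<^sub>R x + b *\<^sub>R y) (a *\<^sub>R x + b *\<^sub>R y)\<bar> \<le> \<kappa> * (norm (a *\<^sub>R x + b *\<^sub>R y))\<^sup>2"
  shows "\<bar>B x y\<bar> \<le> \<kappa> * norm x * norm y"
proof (cases "x = 0 \<or> y = 0")
  case True
  then show ?thesis
    using bilinear_lzero[OF bil] bilinear_rzero[OF bil] by auto
next
  case False
  define n where "n = norm x * norm y"
  have n: "0 < n"
    using False by (simp add: n_def)
  define p q where "p = norm y *\<^sub>R x + norm x *\<^sub>R y" and "q = norm y *\<^sub>R x + (- norm x) *\<^sub>R y"
  have "4 * (n * B x y) = B p p - B q q"
    unfolding p_def q_def bilinear_ladd[OF bil] bilinear_radd[OF bil]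
      bilinear_lmul[OF bil] bilinear_rmul[OF bil]
    using sym by (simp add: n_def algebra_simps)
  moreover have "\<bar>B p p\<bar> \<le> \<kappa> * (norm p)\<^sup>2" "\<bar>B q q\<bar> \<le> \<kappa> * (norm q)\<^sup>2"
    unfolding p_def q_def by (rule bound)+
  moreover have "(norm p)\<^sup>2 + (norm q)\<^sup>2 = 4 * n\<^sup>2"
  proof -
    have "x \<bullet> x = (norm x)\<^sup>2" "y \<bullet> y = (norm y)\<^sup>2"
      by (simp_all add: power2_norm_eq_inner)
    then show ?thesis
      unfolding power2_norm_eq_inner[of p] power2_norm_eq_inner[of q]
      by (simp add: p_def q_def n_def inner_add inner_commute power2_eq_square algebra_simps)
  qed
  ultimately have "4 * (n * \<bar>B x y\<bar>) \<le> \<kappa> * (4 * n\<^sup>2)"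
    using n by (smt (verit) abs_mult abs_of_pos distrib_left)
  then have "n * \<bar>B x y\<bar> \<le> n * (\<kappa> * n)"
    by (simp add: power2_eq_square mult_ac)
  then show ?thesis
    using mult_le_cancel_left_pos[OF n] by (simp add: n_def mult.assoc)
qed

text \<open>Used with \<open>\<alpha> = 1\<close> for the cross term, and with the step size as
  \<open>\<alpha>\<close> for the deviation of a gradient step from an exact one.\<close>

lemma bilinear_scaled_gram:
  "bilinear (\<lambda>Z W. Z \<bullet> W - \<alpha> * (meas_op A Z \<bullet> meas_op A W))"
  unfolding bilinear_def
  by (auto intro!: linearI simp: inner_add inner_scaleR_left linear_add[OF linear_meas_op]
      linear_cmul[OF linear_meas_op] algebra_simps)

lemma rip_cross_term:
  assumes "1 \<le> s" "rank Z \<le> s" "rank W \<le> s'" "Z \<bullet> W = 0"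
  shows "\<bar>meas_op A Z \<bullet> meas_op A W\<bar> \<le> ric A (s + s') * norm Z * norm W"
proof -
  let ?B = "\<lambda>Z W. Z \<bullet> W - 1 * (meas_op A Z \<bullet> meas_op A W)"
  have "\<bar>?B Z W\<bar> \<le> ric A (s + s') * norm Z * norm W"
  proof (rule symmetric_form_bound[OF bilinear_scaled_gram])
    fix a b
    let ?V = "a *\<^sub>R Z + b *\<^sub>R W"
    have "rank ?V \<le> s + s'"
      using rank_add_le rank_scaleR_le assms(2,3) by (smt (verit) add_mono le_trans)
    then show "\<bar>?B ?V ?V\<bar> \<le> ric A (s + s') * (norm ?V)\<^sup>2"
      using ric_bounds[of "s + s'" ?V A] assms(1)
      by (simp add: power2_norm_eq_inner algebra_simps abs_le_iff)
  qed (simp add: inner_commute)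
  then show ?thesis
    using assms(4) by simp
qed

text \<open>Subtracting the least-squares multiple of \<open>v\<close> would lower the squared norm
  by \<open>(d \<bullet> v)\<^sup>2 / (norm v)\<^sup>2\<close>. This supplies the normal equations
  of the Gauss--Newton step without differentiation.\<close>

lemma minimal_residual_orthogonal:
  fixes d v :: "'a::real_inner"
  assumes "\<And>c. norm d \<le> norm (d - c *\<^sub>R v)"
  shows "d \<bullet> v = 0"
proof (cases "v = 0")
  case False
  let ?c = "(d \<bullet> v) / (norm v)\<^sup>2"
  have "(norm d)\<^sup>2 \<le> (norm (d - ?c *\<^sub>R v))\<^sup>2"
    by (intro power_mono assms) simp
  also have "\<dots> = (norm d)\<^sup>2 - 2 * ?c * (d \<bullet> v) + ?c\<^sup>2 * (norm v)\<^sup>2"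
    unfolding power2_norm_eq_inner
    by (simp add: inner_diff inner_commute power2_eq_square[of "_ / _"])
  also have "\<dots> = (norm d)\<^sup>2 - (d \<bullet> v)\<^sup>2 / (norm v)\<^sup>2"
    using False by (simp add: field_simps power2_eq_square)
  finally show ?thesis
    using False by (simp add: divide_le_0_iff)
qed simp

section \<open>One iteration\<close>

locale trace_regression =
  fixes A :: "'n::finite \<Rightarrow> real^'q^'p"
    and Xstar :: "real^'q^'p"
    and \<epsilon> y :: "real^'n"
    and r rstar :: nat
    and R R' \<eta> \<sigma> :: real
  assumes model: "y = meas_op A Xstar + \<epsilon>"
    and rank_star: "rank Xstar = rstar" "1 \<le> rstar"
    and input_rank: "rstar \<le> r"
    and rip: "satisfies_rip A (2 * r)"
    and R: "R = ric A (2 * r)"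
    and R': "R' = ric A (2 * r + rstar)"
    and \<sigma>: "\<sigma> = singular_value rstar Xstar"
    and \<eta>: "\<eta> = norm (best_rank_approx (2 * r) (adjoint (meas_op A) \<epsilon>))"
begin

lemma constants: "0 \<le> R" "R < 1" "R \<le> R'" "0 < \<sigma>" "0 \<le> \<eta>"
proof -
  show "0 \<le> R" "R < 1"
    using rip by (simp_all add: satisfies_rip_def R)
  show "R \<le> R'"
    using rank_star input_rank unfolding R R' by (intro ric_mono) auto
  show "0 < \<sigma>"
    using pseudoinverse_exists[of Xstar] rank_star unfolding \<sigma> by metis
  show "0 \<le> \<eta>"
    by (simp add: \<eta>)
qed

lemma truncation_error_le:
  assumes "is_truncated_svd r W X'"
  shows "norm (X' - Xstar) \<le> 2 * norm (W - Xstar)"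
proof -
  have "norm (X' - Xstar) \<le> norm (W - X') + norm (W - Xstar)"
    by (metis norm_triangle_sub norm_minus_commute diff_diff_eq2 dist_norm dist_triangle3)
  also have "norm (W - X') \<le> norm (W - Xstar)"
    using truncated_svd_best_approx[OF assms] rank_star input_rank by simp
  finally show ?thesis by simp
qed

text \<open>Tangent matrices have rank at most \<open>2 * r\<close>, so the back-projected noise is
  felt only through its best approximation of that rank.\<close>

lemma noise_le:
  assumes "rank V \<le> 2 * r"
  shows "meas_op A V \<bullet> \<epsilon> \<le> norm V * \<eta>"
  using inner_le_norm_best_rank_approx[OF assms, of "adjoint (meas_op A) \<epsilon>"]
  by (simp add: inner_adjoint_meas_op \<eta>)

section \<open>Half steps measured in the tangent space at the current iterate\<close>

context
  fixes X :: "real^'q^'p" and P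
  assumes tangent: "is_tangent_proj r X P"
begin

abbreviation "\<delta> \<equiv> norm (Xstar - P Xstar)"

lemma residual_le: "\<delta> \<le> (norm (X - Xstar))\<^sup>2 / \<sigma>"
  using norm_tangent_residual_le[OF tangent, of Xstar] rank_star by (simp add: \<sigma>)

text \<open>The residual is orthogonal to the tangent matrix \<open>V\<close>, and the ranks are at
  most \<open>rstar\<close> and \<open>2 * r\<close>; this explains the order in
  \<open>R'\<close>.\<close>

lemma residual_cross_term_le:
  assumes "P V = V"
  shows "meas_op A V \<bullet> meas_op A (Xstar - P Xstar) \<le> norm V * (R' * \<delta>)"
proof -
  have "V \<bullet> (Xstar - P Xstar) = 0"
    using tangent_proj_self_adjoint[OF tangent, of V Xstar] assms by (simp add: inner_diff_right)
  then have "\<bar>meas_op A V \<bullet> meas_op A (Xstar - P Xstar)\<bar> \<le> R' * norm V * \<delta>"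
    unfolding R'
    using rank_tangent_proj_le[OF tangent, of V] rank_tangent_residual_le[OF tangent, of Xstar]
      assms rank_star input_rank by (intro rip_cross_term) auto
  then show ?thesis
    by (simp add: mult_ac)
qed

lemma half_step_error_le:
  assumes "(1 - R) * norm (W - P Xstar) \<le> c"
  shows "(1 - R) * norm (W - Xstar) \<le> c + (1 - R) * \<delta>"
proof -
  have "norm (W - Xstar) \<le> norm (W - P Xstar) + \<delta>"
    by (metis dist_norm dist_triangle2 norm_minus_commute)
  then have "(1 - R) * norm (W - Xstar) \<le> (1 - R) * (norm (W - P Xstar) + \<delta>)"
    using constants by (intro mult_left_mono) auto
  then show ?thesis
    using assms by (simp add: distrib_left)
qed

text \<open>The normal equations are tested with the tangent error \<open>V\<close> itself. Then
  \<open>(norm (meas_op A V))\<^sup>2\<close> is the pairing of \<open>meas_op A V\<close> with the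
  measured residual plus noise, and the lower isometry bound allows one factor \<open>norm V\<close>
  to cancel.\<close>

lemma rgn_half_step:
  assumes "is_arg_min (\<lambda>Z. 1/2 * (norm (y - meas_op A (P Z)))\<^sup>2) (\<lambda>Z. Z \<in> range P) W"
  shows "(1 - R) * norm (W - Xstar) \<le> (1 + R' - R) * \<delta> + \<eta>"
proof -
  note lin = linear_tangent_proj[OF tangent]
  note idem = tangent_proj_idem[OF tangent]
  have W: "P W = W"
    using assms idem by (auto simp: is_arg_min_def)
  define V where "V = W - P Xstar"
  have V: "P V = V"
    by (simp add: V_def linear_diff[OF lin] W idem)
  \<comment> \<open>The feasible set \<open>range P\<close> is a linear space, so \<open>W\<close>
    may be varied by any multiple of \<open>V\<close>.\<close>
  have "(y - meas_op A W) \<bullet> meas_op A V = 0"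
  proof (rule minimal_residual_orthogonal)
    fix c
    have PW: "P (W + c *\<^sub>R V) = W + c *\<^sub>R V"
      by (simp add: linear_add[OF lin] linear_cmul[OF lin] W V)
    then have "W + c *\<^sub>R V \<in> range P"
      by (metis rangeI)
    then have "(norm (y - meas_op A (P W)))\<^sup>2 \<le> (norm (y - meas_op A (P (W + c *\<^sub>R V))))\<^sup>2"
      using assms by (auto simp: is_arg_min_linorder)
    then have "norm (y - meas_op A W) \<le> norm (y - meas_op A (W + c *\<^sub>R V))"
      unfolding PW W by simp
    then show "norm (y - meas_op A W) \<le> norm (y - meas_op A W - c *\<^sub>R meas_op A V)"
      by (simp add: linear_add[OF linear_meas_op] linear_cmul[OF linear_meas_op] diff_diff_eq)
  qed
  then have "meas_op A V \<bullet> meas_op A W = meas_op A V \<bullet> y"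
    by (simp add: inner_diff inner_commute)
  then have "(norm (meas_op A V))\<^sup>2 = meas_op A V \<bullet> (y - meas_op A (P Xstar))"
    unfolding power2_norm_eq_inner
    by (subst (2) V_def) (simp add: linear_diff[OF linear_meas_op] inner_diff_right)
  also have "\<dots> = meas_op A V \<bullet> meas_op A (Xstar - P Xstar) + meas_op A V \<bullet> \<epsilon>"
    by (simp add: model linear_diff[OF linear_meas_op] inner_diff_right inner_add_right)
  also have "\<dots> \<le> norm V * (R' * \<delta>) + norm V * \<eta>"
    using rank_tangent_proj_le[OF tangent, of V] V
    by (intro add_mono residual_cross_term_le noise_le) auto
  finally have "(1 - R) * (norm V)\<^sup>2 \<le> norm V * (R' * \<delta> + \<eta>)"
    using ric_bounds(1)[of "2 * r" V A] rank_tangent_proj_le[OF tangent, of V] V rank_star input_rank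
    by (simp add: R distrib_left)
  then have "norm V * ((1 - R) * norm V) \<le> norm V * (R' * \<delta> + \<eta>)"
    by (simp add: power2_eq_square mult_ac)
  moreover have "0 \<le> R' * \<delta> + \<eta>"
    using constants by simp
  ultimately have "(1 - R) * norm V \<le> R' * \<delta> + \<eta>"
    by (cases "V = 0") auto
  from half_step_error_le[OF this[unfolded V_def]] show ?thesis
    by (simp add: algebra_simps)
qed

text \<open>On the tangent space the Rayleigh quotients of the Gram form lie between
  \<open>1 - R\<close> and \<open>1 + R\<close>. Scaled by \<open>\<alpha>\<close>, they exceed 1 by
  at most \<open>2 * R / (1 - R)\<close> and fall short of it by at most
  \<open>2 * R / (1 + R)\<close>; the larger deviation is the constant.\<close>

lemma scaled_gram_le:
  assumes "1 / (1 + R) \<le> \<alpha>" "\<alpha> \<le> 1 / (1 - R)" "P Z = Z" "P W = W"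
  shows "Z \<bullet> W - \<alpha> * (meas_op A Z \<bullet> meas_op A W) \<le> 2 * R / (1 - R) * norm Z * norm W"
proof -
  note lin = linear_tangent_proj[OF tangent]
  let ?B = "\<lambda>Z W. Z \<bullet> W - \<alpha> * (meas_op A Z \<bullet> meas_op A W)"
  have "\<bar>?B Z W\<bar> \<le> 2 * R / (1 - R) * norm Z * norm W"
  proof (rule symmetric_form_bound[OF bilinear_scaled_gram])
    fix a b
    define V where "V = a *\<^sub>R Z + b *\<^sub>R W"
    have "P V = V"
      by (simp add: V_def linear_add[OF lin] linear_cmul[OF lin] assms)
    then have "rank V \<le> 2 * r"
      using rank_tangent_proj_le[OF tangent, of V] by simp
    then have V: "(1 - R) * (norm V)\<^sup>2 \<le> (norm (meas_op A V))\<^sup>2"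
        "(norm (meas_op A V))\<^sup>2 \<le> (1 + R) * (norm V)\<^sup>2"
      using ric_bounds[of "2 * r" V A] rank_star input_rank by (auto simp: R)
    have "\<alpha> * (norm (meas_op A V))\<^sup>2 \<le> 1 / (1 - R) * ((1 + R) * (norm V)\<^sup>2)"
      using assms V constants by (intro mult_mono) auto
    also have "\<dots> = (norm V)\<^sup>2 + 2 * R / (1 - R) * (norm V)\<^sup>2"
      using constants by (simp add: field_simps)
    finally have upper: "\<alpha> * (norm (meas_op A V))\<^sup>2 \<le> (norm V)\<^sup>2 + 2 * R / (1 - R) * (norm V)\<^sup>2" .
    have "(norm V)\<^sup>2 - 2 * R / (1 - R) * (norm V)\<^sup>2 \<le> (norm V)\<^sup>2 - 2 * R / (1 + R) * (norm V)\<^sup>2"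
      using constants by (intro diff_left_mono mult_right_mono frac_le) auto
    also have "\<dots> = 1 / (1 + R) * ((1 - R) * (norm V)\<^sup>2)"
      using constants by (simp add: field_simps)
    also have "\<dots> \<le> \<alpha> * (norm (meas_op A V))\<^sup>2"
    proof (rule mult_mono)
      show "0 \<le> \<alpha>"
        using constants by (intro order_trans[OF _ assms(1)]) simp
    qed (use assms V constants in auto)
    finally have "\<bar>?B V V\<bar> \<le> 2 * R / (1 - R) * (norm V)\<^sup>2"
      using upper by (simp add: power2_norm_eq_inner abs_le_iff)
    then show "\<bar>?B (a *\<^sub>R Z + b *\<^sub>R W) (a *\<^sub>R Z + b *\<^sub>R W)\<bar>
        \<le> 2 * R / (1 - R) * (norm (a *\<^sub>R Z + b *\<^sub>R W))\<^sup>2"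
      by (simp add: V_def)
  qed (simp add: inner_commute)
  then show ?thesis by simp
qed

text \<open>The step size is the reciprocal Rayleigh quotient of the tangent matrix
  \<open>G\<close>, so the isometry bounds confine it to the interval in
  \<open>scaled_gram_le\<close>. The squared norm of the new tangent error \<open>V\<close> then
  splits into a contracted pairing with the old one \<open>T\<close>, the cross term and the
  noise.\<close>

lemma rgd_half_step:
  defines "G \<equiv> P (adjoint (meas_op A) (meas_op A X - y))"
  defines "W \<equiv> X - ((norm G)\<^sup>2 / (norm (meas_op A G))\<^sup>2) *\<^sub>R G"
  shows "(1 - R) * norm (W - Xstar) \<le> 2 * R * norm (X - Xstar) + (1 + R' - R) * \<delta> + \<eta>"
proof -
  note lin = linear_tangent_proj[OF tangent]
  note idem = tangent_proj_idem[OF tangent]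
  note lin_op = linear_diff[OF linear_meas_op]
  have G: "P G = G"
    by (simp add: G_def idem)
  obtain \<alpha> where \<alpha>: "1 / (1 + R) \<le> \<alpha>" "\<alpha> \<le> 1 / (1 - R)" and W: "W = X - \<alpha> *\<^sub>R G"
  proof (cases "G = 0")
    \<comment> \<open>Division by zero makes the computed step size 0, outside the interval; since
      it multiplies \<open>G = 0\<close>, it can be replaced by 1.\<close>
    case True
    have "1 / (1 + R) \<le> 1" "1 \<le> 1 / (1 - R)"
      using constants by simp_all
    then show ?thesis
      using that[of 1] True by (simp add: W_def)
  next
    case False
    have "(1 - R) * (norm G)\<^sup>2 \<le> (norm (meas_op A G))\<^sup>2"
        "(norm (meas_op A G))\<^sup>2 \<le> (1 + R) * (norm G)\<^sup>2"
      using ric_bounds[of "2 * r" G A] rank_tangent_proj_le[OF tangent, of G] G rank_star input_rank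
      by (auto simp: R)
    moreover from this(1) have "0 < (norm (meas_op A G))\<^sup>2"
      using False constants by (smt (verit) mult_pos_pos zero_less_norm_iff zero_less_power)
    ultimately have "1 / (1 + R) \<le> (norm G)\<^sup>2 / (norm (meas_op A G))\<^sup>2"
        "(norm G)\<^sup>2 / (norm (meas_op A G))\<^sup>2 \<le> 1 / (1 - R)"
      using constants by (simp_all add: divide_simps mult_ac split: if_splits)
    then show ?thesis
      using that W_def by blast
  qed
  have \<alpha>0: "0 \<le> \<alpha>"
    using constants by (intro order_trans[OF _ \<alpha>(1)]) simp
  define T where "T = X - P Xstar"
  define V where "V = T - \<alpha> *\<^sub>R G"
  have T: "P T = T"
    by (simp add: T_def linear_diff[OF lin] tangent_proj_base[OF tangent] idem)
  have V: "P V = V"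
    by (simp add: V_def linear_diff[OF lin] linear_cmul[OF lin] T G)
  have "T = P (X - Xstar)"
    by (simp add: T_def linear_diff[OF lin] tangent_proj_base[OF tangent])
  then have nT: "norm T \<le> norm (X - Xstar)"
    using norm_tangent_proj_le[OF tangent] by simp
  have "V \<bullet> G = meas_op A V \<bullet> (meas_op A X - y)"
    unfolding G_def by (metis V inner_adjoint_meas_op tangent_proj_self_adjoint[OF tangent])
  also have "\<dots> = meas_op A V \<bullet> meas_op A T - meas_op A V \<bullet> meas_op A (Xstar - P Xstar)
      - meas_op A V \<bullet> \<epsilon>"
    by (simp add: T_def model lin_op inner_diff_right inner_add_right)
  finally have VG: "V \<bullet> G = meas_op A V \<bullet> meas_op A T
      - meas_op A V \<bullet> meas_op A (Xstar - P Xstar) - meas_op A V \<bullet> \<epsilon>" .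
  have "(norm V)\<^sup>2 = V \<bullet> T - \<alpha> * (V \<bullet> G)"
    unfolding power2_norm_eq_inner by (subst (2) V_def) (simp add: inner_diff_right)
  also have "\<dots> = (V \<bullet> T - \<alpha> * (meas_op A V \<bullet> meas_op A T)) +
      \<alpha> * (meas_op A V \<bullet> meas_op A (Xstar - P Xstar) + meas_op A V \<bullet> \<epsilon>)"
    unfolding VG by (simp add: algebra_simps)
  also have "\<dots> \<le> 2 * R / (1 - R) * norm V * norm T + \<alpha> * (norm V * (R' * \<delta>) + norm V * \<eta>)"
    using rank_tangent_proj_le[OF tangent, of V] V \<alpha>0
    by (intro add_mono scaled_gram_le \<alpha> T V mult_left_mono residual_cross_term_le noise_le) auto
  also have "\<dots> \<le> 2 * R / (1 - R) * norm V * norm (X - Xstar) +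
      1 / (1 - R) * (norm V * (R' * \<delta>) + norm V * \<eta>)"
    using constants nT \<alpha> by (intro add_mono mult_left_mono mult_right_mono) auto
  also have "\<dots> = norm V * (2 * R * norm (X - Xstar) + R' * \<delta> + \<eta>) / (1 - R)"
    by (simp add: algebra_simps add_divide_distrib)
  finally have "norm V * ((1 - R) * norm V) \<le> norm V * (2 * R * norm (X - Xstar) + R' * \<delta> + \<eta>)"
    using constants by (simp add: field_simps power2_eq_square)
  moreover have "0 \<le> 2 * R * norm (X - Xstar) + R' * \<delta> + \<eta>"
    using constants by simp
  ultimately have "(1 - R) * norm V \<le> 2 * R * norm (X - Xstar) + R' * \<delta> + \<eta>"
    by (cases "V = 0") auto
  moreover have "V = W - P Xstar"
    by (simp add: V_def T_def W)
  ultimately show ?thesis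
    using half_step_error_le[of W "2 * R * norm (X - Xstar) + R' * \<delta> + \<eta>"]
    by (simp add: algebra_simps)
qed

end

text \<open>Common to both methods: \<open>a\<close> is what the half step retains linearly of the
  old error, namely 0 for Gauss--Newton and \<open>2 * R * norm (X - Xstar)\<close> for gradient
  descent.\<close>

lemma step_error_le:
  assumes tangent: "is_tangent_proj r X P" and trunc: "is_truncated_svd r W X'"
    and half: "(1 - R) * norm (W - Xstar) \<le> a + (1 + R' - R) * norm (Xstar - P Xstar) + \<eta>"
  shows "norm (X' - Xstar) \<le> 2 * a / (1 - R) +
      2 * (1 + R' - R) / ((1 - R) * \<sigma>) * (norm (X - Xstar))\<^sup>2 + 2 * \<eta> / (1 - R)"
proof -
  have "(1 + R' - R) * norm (Xstar - P Xstar) \<le> (1 + R' - R) * ((norm (X - Xstar))\<^sup>2 / \<sigma>)"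
    using residual_le[OF tangent] constants by (intro mult_left_mono) auto
  with half have "(1 - R) * norm (W - Xstar) \<le> a + (1 + R' - R) * ((norm (X - Xstar))\<^sup>2 / \<sigma>) + \<eta>"
    by linarith
  then have "norm (W - Xstar) \<le> (a + (1 + R' - R) * ((norm (X - Xstar))\<^sup>2 / \<sigma>) + \<eta>) / (1 - R)"
    using constants by (simp add: pos_le_divide_eq mult.commute)
  with truncation_error_le[OF trunc]
  have "norm (X' - Xstar) \<le> 2 * ((a + (1 + R' - R) * ((norm (X - Xstar))\<^sup>2 / \<sigma>) + \<eta>) / (1 - R))"
    by linarith
  also have "\<dots> = 2 * a / (1 - R) +
      2 * (1 + R' - R) / ((1 - R) * \<sigma>) * (norm (X - Xstar))\<^sup>2 + 2 * \<eta> / (1 - R)"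
    by (simp add: add_divide_distrib distrib_left mult.assoc mult.commute[of \<sigma>])
  finally show ?thesis .
qed

lemma rgn_step_error_le:
  assumes "rgn_step A y r X X'"
  shows "norm (X' - Xstar) \<le>
      2 * (1 + R' - R) / ((1 - R) * \<sigma>) * (norm (X - Xstar))\<^sup>2 + 2 * \<eta> / (1 - R)"
proof -
  obtain P W where P: "is_tangent_proj r X P"
    and W: "is_arg_min (\<lambda>Z. 1/2 * (norm (y - meas_op A (P Z)))\<^sup>2) (\<lambda>Z. Z \<in> range P) W"
    and X': "is_truncated_svd r W X'"
    using assms by (auto simp: rgn_step_def)
  show ?thesis
    using step_error_le[OF P X', of 0] rgn_half_step[OF P W] by simp
qed

lemma rgd_step_error_le:
  assumes "rgd_step A y r X X'"
  shows "norm (X' - Xstar) \<le> 4 * R / (1 - R) * norm (X - Xstar) +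
      2 * (1 + R' - R) / ((1 - R) * \<sigma>) * (norm (X - Xstar))\<^sup>2 + 2 * \<eta> / (1 - R)"
proof -
  obtain P where P: "is_tangent_proj r X P"
    and X': "is_truncated_svd r
      (X - ((norm (P (adjoint (meas_op A) (meas_op A X - y))))\<^sup>2 /
        (norm (meas_op A (P (adjoint (meas_op A) (meas_op A X - y)))))\<^sup>2) *\<^sub>R
          P (adjoint (meas_op A) (meas_op A X - y))) X'"
    using assms by (auto simp: rgd_step_def Let_def)
  show ?thesis
    using step_error_le[OF P X', of "2 * R * norm (X - Xstar)"] rgd_half_step[OF P]
    by simp
qed

end

section \<open>Convergence\<close>

text \<open>The linear bound holds only inside the radius \<open>\<delta>\<close>, so the induction
  also carries that the iterates stay there: \<open>3 / 8 * \<delta> + b \<le> \<delta>\<close>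
  because \<open>2 * b \<le> \<delta>\<close>. The noise is absorbed since
  \<open>3 / 8 * (2 * b) + b \<le> 2 * b\<close>.\<close>

lemma contraction_recurrence:
  fixes e :: "nat \<Rightarrow> real"
  assumes step: "\<And>t. e t \<le> \<delta> \<Longrightarrow> e (Suc t) \<le> 3 / 8 * e t + b"
    and init: "0 \<le> e 0" "e 0 \<le> \<delta>" "0 \<le> b" "2 * b \<le> \<delta>"
  shows "e t \<le> (1/2) ^ t * e 0 + 2 * b"
proof -
  have "e t \<le> \<delta> \<and> e t \<le> (1/2) ^ t * e 0 + 2 * b"
  proof (induction t)
    case (Suc t)
    have "0 \<le> (1/2) ^ t * e 0"
      using init by simp
    moreover have "e (Suc t) \<le> 3 / 8 * e t + b"
      using Suc step by simp
    ultimately have "e (Suc t) \<le> 1 / 2 * ((1/2) ^ t * e 0) + 2 * b" "e (Suc t) \<le> \<delta>"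
      using Suc init by linarith+
    then show ?case by simp
  qed (use init in simp)
  then show ?thesis by simp
qed

text \<open>The bound \<open>x + 2 * b\<close> alone is not preserved by \<open>e \<mapsto> c * e\<^sup>2 + b\<close> when \<open>4 * c * b = 1\<close>,
  since \<open>2 * b\<close> is then a double fixed point; the correction \<open>- 8 * c * x * b\<close> leaves
  the room that is needed.\<close>

lemma quadratic_recurrence:
  fixes e :: "nat \<Rightarrow> real"
  assumes step: "\<And>t. e (Suc t) \<le> c * (e t)\<^sup>2 + b"
    and nonneg: "\<And>t. 0 \<le> e t" "0 \<le> c" "0 \<le> b"
    and small: "4 * c * e 0 \<le> 1" "4 * c * b \<le> 1"
    and "1 \<le> t"
  shows "e t \<le> (1/2) ^ (2 ^ t) * e 0 + 2 * b"
proof -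
  define q :: "nat \<Rightarrow> real" where "q t = (1/2) ^ (2 ^ t)" for t
  have "q t \<le> (1/2) ^ 2" if "1 \<le> t" for t
    unfolding q_def using power_increasing[of 1 t "2::nat"] that
    by (intro power_decreasing) auto
  then have q: "0 \<le> q t" "1 \<le> t \<Longrightarrow> q t \<le> 1 / 4" "q (Suc t) = q t * q t" for t
    by (simp_all add: q_def power2_eq_square mult_2 flip: power_add)
  have "e t \<le> q t * e 0 + (2 - 8 * c * (q t * e 0)) * b"
    using \<open>1 \<le> t\<close>
  proof (induction t rule: dec_induct)
    \<comment> \<open>Here \<open>q 1 = 1 / 4\<close>, and the correction
      \<open>2 * c * e 0 * b\<close> is at most \<open>b / 2\<close>, which the spare
      \<open>b\<close> covers.\<close>
    case base
    have "c * (e 0)\<^sup>2 \<le> 1 / 4 * e 0"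
      using mult_right_mono[OF small(1) nonneg(1)[of 0]] by (simp add: power2_eq_square)
    moreover have "4 * c * e 0 * b \<le> 1 * b"
      by (intro mult_right_mono small nonneg)
    ultimately show ?case
      using step[of 0] nonneg by (simp add: q_def power2_eq_square algebra_simps)
  next
    case (step t)
    define x where "x = q t * e 0"
    define z where "z = 4 * c * x"
    have x: "0 \<le> x" "x \<le> 1 / 4 * e 0"
      unfolding x_def using q(1) q(2)[OF step.hyps(1)] nonneg(1) by (simp, intro mult_right_mono)
    have "z \<le> 4 * c * (1 / 4 * e 0)"
      unfolding z_def using x nonneg by (intro mult_left_mono) auto
    then have z: "0 \<le> z" "z \<le> 1 / 4"
      using x nonneg small by (auto simp: z_def)
    have "e (Suc t) \<le> c * (x + (2 - 2 * z) * b)\<^sup>2 + b"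
    proof -
      have "e t \<le> x + (2 - 2 * z) * b"
        using step.IH by (simp add: x_def z_def mult_ac)
      then have "(e t)\<^sup>2 \<le> (x + (2 - 2 * z) * b)\<^sup>2"
        using nonneg by (intro power_mono) auto
      then show ?thesis
        using assms(1)[of t] nonneg by (smt (verit) mult_left_mono)
    qed
    \<comment> \<open>In terms of \<open>z\<close> the mixed term is \<open>(1 - z) * b * z\<close>;
      added to \<open>(1 - z)\<^sup>2 * b\<close> it collapses to
      \<open>(1 - z) * b\<close>.\<close>
    also have "c * (x + (2 - 2 * z) * b)\<^sup>2 =
        c * x\<^sup>2 + (1 - z) * b * z + (4 * c * b) * ((1 - z)\<^sup>2 * b)"
      by (simp add: z_def power2_eq_square algebra_simps)
    also have "(4 * c * b) * ((1 - z)\<^sup>2 * b) \<le> 1 * ((1 - z)\<^sup>2 * b)"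
      using small nonneg by (intro mult_right_mono) auto
    also have "c * x\<^sup>2 \<le> q (Suc t) * e 0"
    proof -
      have "c * x\<^sup>2 = q (Suc t) * e 0 * (c * e 0)"
        by (simp add: x_def q(3) power2_eq_square mult_ac)
      also have "\<dots> \<le> q (Suc t) * e 0 * 1"
        using small q(1) nonneg by (intro mult_left_mono) auto
      finally show ?thesis by simp
    qed
    finally have "e (Suc t) \<le> q (Suc t) * e 0 + (2 - z) * b"
      by (simp add: power2_eq_square algebra_simps)
    \<comment> \<open>Squaring \<open>q t\<close> shrinks the correction: the new one is
      \<open>2 * (q t * z)\<close>, at most \<open>z / 2\<close>.\<close>
    also have "2 - z \<le> 2 - 8 * c * (q (Suc t) * e 0)"
    proof -
      have "8 * c * (q (Suc t) * e 0) = 2 * (q t * z)"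
        by (simp add: z_def x_def q(3))
      also have "\<dots> \<le> 2 * (1 / 4 * z)"
        using q(2) step.hyps z by (intro mult_left_mono mult_right_mono) auto
      finally show ?thesis
        using z by simp
    qed
    finally show ?case
      using nonneg by (simp add: mult_right_mono)
  qed
  also have "\<dots> \<le> q t * e 0 + 2 * b"
    using q(1) nonneg by (intro add_left_mono mult_right_mono) auto
  finally show ?thesis
    by (simp add: q_def)
qed

text \<open>The Gauss--Newton bound starts at \<open>t = 1\<close>: at \<open>t = 0\<close> its
  factor is 1/2, which without noise would force \<open>X 0 = Xstar\<close>. Its noise condition
  amounts to \<open>4 * c * b \<le> 1\<close>, under which
  \<open>e \<mapsto> c * e\<^sup>2 + b\<close> has a real fixed point.\<close>

theorem corollary1:
  fixes A :: "'n::finite \<Rightarrow> real^'q^'p"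
    and Xstar :: "real^'q^'p"
    and \<epsilon> y :: "real^'n"
    and r rstar :: nat
    and R R' \<eta> \<sigma> :: real
  assumes model: "y = meas_op A Xstar + \<epsilon>"
    and rank_star: "rank Xstar = rstar" "1 \<le> rstar"
    and input_rank: "rstar \<le> r"
    and rip: "satisfies_rip A (2 * r)"
    and R: "R = ric A (2 * r)"
    and R': "R' = ric A (2 * r + rstar)"
    and \<sigma>: "\<sigma> = singular_value rstar Xstar"
    and \<eta>: "\<eta> = norm (best_rank_approx (2 * r) (adjoint (meas_op A) \<epsilon>))"
  shows "(\<forall>X. rgd_iterates A y r X \<longrightarrow>
            norm (X 0 - Xstar) \<le> R / (1 + R' - R) * \<sigma> \<longrightarrow>
            R \<le> 1 / 17 \<longrightarrow>
            4 * (1 + R' - R) * \<eta> \<le> R * (1 - R) * \<sigma> \<longrightarrow>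
            (\<forall>t. norm (X t - Xstar) \<le> (1/2) ^ t * norm (X 0 - Xstar) + 4 / (1 - R) * \<eta>) \<and>
            (\<epsilon> = 0 \<longrightarrow> (\<forall>t. norm (X t - Xstar) \<le> (1/2) ^ t * norm (X 0 - Xstar)))) \<and>
         (\<forall>X. rgn_iterates A y r X \<longrightarrow>
            norm (X 0 - Xstar) \<le> (1 - R) / (8 * (1 + R' - R)) * \<sigma> \<longrightarrow>
            (16 * (1 + R' - R) / (1 - R)\<^sup>2 * \<eta> \<le> \<sigma> \<longrightarrow>
              (\<forall>t\<ge>1. norm (X t - Xstar) \<le> (1/2) ^ (2 ^ t) * norm (X 0 - Xstar) + 4 / (1 - R) * \<eta>)) \<and>
            (\<epsilon> = 0 \<longrightarrow>
              (\<forall>t\<ge>1. norm (X t - Xstar) \<le> (1/2) ^ (2 ^ t) * norm (X 0 - Xstar))))"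
proof -
  interpret trace_regression A Xstar \<epsilon> y r rstar R R' \<eta> \<sigma>
    by standard fact+
  define K where "K = 1 + R' - R"
  define b where "b = 2 * \<eta> / (1 - R)"
  define c where "c = 2 * K / ((1 - R) * \<sigma>)"
  have pos: "0 < K" "0 < 1 - R" "0 < \<sigma>" "0 \<le> R" "0 \<le> \<eta>"
    using constants by (auto simp: K_def)
  have b: "0 \<le> b" "4 / (1 - R) * \<eta> = 2 * b" and c: "0 \<le> c"
    using pos by (auto simp: b_def c_def)
  have noiseless: "\<eta> = 0" if "\<epsilon> = 0"
  proof -
    have "adjoint (meas_op A) 0 = 0"
      by (rule linear_0[OF adjoint_linear[OF linear_meas_op]])
    then show ?thesis
      by (simp add: \<eta> that best_rank_approx_0)
  qed
  have rgd: "norm (X t - Xstar) \<le> (1/2) ^ t * norm (X 0 - Xstar) + 4 / (1 - R) * \<eta>"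
    if X: "rgd_iterates A y r X" and init: "norm (X 0 - Xstar) \<le> R / K * \<sigma>"
      and small: "R \<le> 1 / 17" "4 * K * \<eta> \<le> R * (1 - R) * \<sigma>" for X t
    unfolding b(2)
  \<comment> \<open>The radius is the assumed bound on the initial error, and the noise assumption
    of gradient descent says exactly that \<open>2 * b\<close> does not exceed it.\<close>
  proof (rule contraction_recurrence[where \<delta> = "R / K * \<sigma>"])
    show "2 * b \<le> R / K * \<sigma>"
      using small(2) pos by (simp add: b_def field_simps)
    fix t
    let ?e = "norm (X t - Xstar)"
    assume "?e \<le> R / K * \<sigma>"
    then have "c * ?e \<le> c * (R / K * \<sigma>)"
      using c by (intro mult_left_mono)
    also have "\<dots> = 2 * (R / (1 - R))"
      using pos by (simp add: c_def field_simps)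
    finally have ce: "c * ?e \<le> 2 * (R / (1 - R))" .
    \<comment> \<open>Origin of 1/17: the linear term contributes at most 4/16 and the quadratic
      one, inside the radius, at most 2/16, in total 3/8.\<close>
    have "R / (1 - R) \<le> 1 / 16"
      using small(1) pos by (simp add: field_simps)
    then have "4 * R / (1 - R) + c * ?e \<le> 3 / 8"
      using ce by simp
    then have "(4 * R / (1 - R) + c * ?e) * ?e \<le> 3 / 8 * ?e"
      by (intro mult_right_mono) simp_all
    moreover have "norm (X (Suc t) - Xstar) \<le> 4 * R / (1 - R) * ?e + c * ?e\<^sup>2 + b"
      unfolding c_def K_def b_def using X by (intro rgd_step_error_le) (simp add: rgd_iterates_def)
    ultimately show "norm (X (Suc t) - Xstar) \<le> 3 / 8 * ?e + b"
      by (simp add: distrib_right power2_eq_square)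
  qed (use b init in auto)
  have rgn: "norm (X t - Xstar) \<le> (1/2) ^ (2 ^ t) * norm (X 0 - Xstar) + 4 / (1 - R) * \<eta>"
    if X: "rgn_iterates A y r X" and init: "norm (X 0 - Xstar) \<le> (1 - R) / (8 * K) * \<sigma>"
      and small: "16 * K / (1 - R)\<^sup>2 * \<eta> \<le> \<sigma>" and "1 \<le> t" for X t
    unfolding b(2)
  proof (rule quadratic_recurrence)
    show "norm (X (Suc t) - Xstar) \<le> c * (norm (X t - Xstar))\<^sup>2 + b" for t
      unfolding c_def K_def b_def using X by (intro rgn_step_error_le) (simp add: rgn_iterates_def)
    \<comment> \<open>The initialization bound rearranged: 4 times the factor 2 inside
      \<open>c\<close> is the 8 in the radius.\<close>
    show "4 * c * norm (X 0 - Xstar) \<le> 1"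
      using init pos by (simp add: c_def field_simps)
    show "4 * c * b \<le> 1"
    proof -
      have "4 * c * b = 16 * K / (1 - R)\<^sup>2 * \<eta> / \<sigma>"
        by (simp add: c_def b_def power2_eq_square mult_ac)
      also have "\<dots> \<le> \<sigma> / \<sigma>"
        using pos by (intro divide_right_mono small) simp
      finally show ?thesis
        using pos by simp
    qed
  qed (use b c \<open>1 \<le> t\<close> in auto)
  have rgd0: "norm (X t - Xstar) \<le> (1/2) ^ t * norm (X 0 - Xstar)"
    if "rgd_iterates A y r X" "norm (X 0 - Xstar) \<le> R / K * \<sigma>" "R \<le> 1 / 17"
      "4 * K * \<eta> \<le> R * (1 - R) * \<sigma>" "\<epsilon> = 0" for X t
    using rgd[OF that(1-4), of t] noiseless[OF that(5)] by simp
  \<comment> \<open>With \<open>\<eta> = 0\<close> the noise condition reads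
    \<open>0 \<le> \<sigma>\<close>.\<close>
  have rgn0: "norm (X t - Xstar) \<le> (1/2) ^ (2 ^ t) * norm (X 0 - Xstar)"
    if "rgn_iterates A y r X" "norm (X 0 - Xstar) \<le> (1 - R) / (8 * K) * \<sigma>" "1 \<le> t" "\<epsilon> = 0" for X t
    using rgn[OF that(1,2) _ that(3)] noiseless[OF that(4)] pos by simp
  show ?thesis
    unfolding K_def[symmetric] by (intro conjI allI impI rgd rgd0 rgn rgn0) assumption+
qed

end
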